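(* Let $\alpha,\beta,\gamma,\zeta,\sigma\in\mathbb R$, $T>0$, and a fixed initial value $\Sigma_0=(\Sigma_{x,0},\Sigma_{xy,0},\Sigma_{y,0})\in\mathbb R^3$ (independent of $\epsilon$) be given. With $A_\Sigma(\epsilon)$, $p_\Sigma$, $q_\Sigma$, $\lambda_\Sigma$, $\lambda_{\Sigma,\epsilon}$ as in the context, assume that there is $\mu_{\Sigma,-}>0$ such that for every $\epsilon\in(0,1)$ all eigenvalues of $A_\Sigma(\epsilon)$ have real part at least $\mu_{\Sigma,-}$, that $\lambda_\Sigma\neq0$, and that $\lambda_{\Sigma,\epsilon}\neq 0$ for all $\epsilon\in(0,1)$. Let $\Sigma(t)=(\Sigma_x,\Sigma_{xy},\Sigma_y)(t)$ be the solution of the multiscale covariance ODE with $\Sigma(0)=\Sigma_0$, and let $\Sigma^k_n$ be the micro iterates of the micro-macro Parareal algorithm (both in the context), whose fine and coarse propagators are the exact solution maps over time $\Delta t$ of the multiscale and the reduced ODE respectively, on the grid $t_n=n\Delta t$, $0\le n\le N$, $N\Delta t=T$. Let $e^k_{\Sigma,n}=\Sigma^k_n-\Sigma(t_n)\in\mathbb R^3$ be the micro error and $E^k_{\Sigma,n}=(\Sigma_x)^k_n-\Sigma_x(t_n)\in\mathbb R$ (difference of the first components) be the macro error. Put $t^{\mathrm{BL}}_{\Sigma,\epsilon}=\frac{2\epsilon}{\mu_{\Sigma,-}}\ln\left(\frac1\epsilon\right)$. Then there exists $\epsilon_0\in(0,1)$, depending only on $\alpha$, $p_\Sigma$, $q_\Sigma$,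 the matrix function $A_\Sigma(\cdot)$ and $T$, such that for every $k\ge0$ and every step size $\Delta t$ there is a constant $C_k$, independent of $\epsilon$, such that for all $\epsilon\in(0,\epsilon_0)$ with $\Delta t>t^{\mathrm{BL}}_{\Sigma,\epsilon}$, $$\sup_{0\le n\le N}|E^k_{\Sigma,n}|\le C_k\,\epsilon^{\lceil (k+1)/2\rceil},\qquad \sup_{0\le n\le N}\|e^k_{\Sigma,n}\|\le C_k\,\epsilon^{\lfloor (k+1)/2\rfloor}.$$
   Context: Multiscale covariance ODE (fine model), for $t\in[0,T]$: $$\frac{d}{dt}\begin{bmatrix}\Sigma_x\\ \Sigma_{xy}\\ \Sigma_y\end{bmatrix}=\begin{bmatrix}2\alpha&2\beta&0\\ \gamma/\epsilon&\alpha+\zeta/\epsilon&\beta\\ 0&2\gamma/\epsilon&2\zeta/\epsilon\end{bmatrix}\begin{bmatrix}\Sigma_x\\ \Sigma_{xy}\\ \Sigma_y\end{bmatrix}+\begin{bmatrix}\sigma^2\\0\\ \sigma^2/\epsilon\end{bmatrix}.$$ Its matrix is written in blocks as $B_\Sigma(\epsilon)=\begin{bmatrix}2\alpha&p_\Sigma^T\\ q_\Sigma/\epsilon&-A_\Sigma(\epsilon)/\epsilon\end{bmatrix}$ with $p_\Sigma=(2\beta,0)^T$, $q_\Sigma=(\gamma,0)^T$, $A_\Sigma(\epsilon)=-\begin{bmatrix}\alpha\epsilon+\zeta&\beta\epsilon\\2\gamma&2\zeta\end{bmatrix}$. Reduced ODE (coarse model): $\frac{d\Sigma_X}{dt}=\lambda_\Sigma\Sigma_X+\sigma^2$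 with $\lambda_\Sigma=2\left(\alpha-\frac{\beta\gamma}{\zeta}\right)$. Also $\lambda_{\Sigma,\epsilon}=2\alpha+p_\Sigma^TA_\Sigma(\epsilon)^{-1}q_\Sigma$. Coupling operators: $\mathcal R(\Sigma_x,\Sigma_{xy},\Sigma_y)=\Sigma_x$; $\mathcal M(S,(\Sigma_x,\Sigma_{xy},\Sigma_y))=(S,\Sigma_{xy},\Sigma_y)$; $\mathcal L(S)=(S,\Sigma_{xy,0},\Sigma_{y,0})$. Micro-macro Parareal with fine propagator $\mathcal F$ (the time-$\Delta t$ solution map of the multiscale ODE, on $\mathbb R^3$) and coarse propagator $\mathcal C$ (the time-$\Delta t$ solution map of the reduced ODE, on $\mathbb R$). Macro iterates $X^k_n\in\mathbb R$ and micro iterates $\Sigma^k_n\in\mathbb R^3$, for $0\le n\le N-1$: initialization $X^0_0=\Sigma_{x,0}$, $X^0_{n+1}=\mathcal C(X^0_n)$, $\Sigma^0_0=\Sigma_0$, $\Sigma^0_{n+1}=\mathcal L(X^0_{n+1})$; and for $k\ge0$, $X^{k+1}_0=\Sigma_{x,0}$, $\Sigma^{k+1}_0=\Sigma_0$, $$X^{k+1}_{n+1}=\mathcal C(X^{k+1}_n)+\mathcal R(\mathcal F(\Sigma^k_n))-\mathcal C(X^k_n),\qquad \Sigma^{k+1}_{n+1}=\mathcal M\big(X^{k+1}_{n+1},\mathcal F(\Sigma^k_n)\big).$$ (Hence $X^k_n=\mathcal R\Sigma^k_n=(\Sigma_x)^k_n$.) $\|\cdot\|$ is the Euclidean norm.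 *)

theory Defs
  imports "HOL-Analysis.Analysis"
begin

definition solves_ivp ::
  "('a::real_normed_vector \<Rightarrow> 'a) \<Rightarrow> 'a \<Rightarrow> real \<Rightarrow> (real \<Rightarrow> 'a) \<Rightarrow> bool" where
  "solves_ivp f y0 h y \<longleftrightarrow>
     y 0 = y0 \<and> (\<forall>t\<in>{0..h}. (y has_vector_derivative f (y t)) (at t within {0..h}))"

(* All right-hand sides used below are affine, so the solution y exists and is unique,
   and the predicate determines \<Phi> uniquely. *)
definition is_solution_map ::
  "('a::real_normed_vector \<Rightarrow> 'a) \<Rightarrow> real \<Rightarrow> ('a \<Rightarrow> 'a) \<Rightarrow> bool" where
  "is_solution_map f h \<Phi> \<longleftrightarrow> (\<forall>y0. \<exists>y. solves_ivp f y0 h y \<and> \<Phi> y0 = y h)"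

definition complex_eigenvalue :: "real^'n^'n \<Rightarrow> complex \<Rightarrow> bool" where
  "complex_eigenvalue A z \<longleftrightarrow>
     (\<exists>v :: complex^'n. v \<noteq> 0 \<and> map_matrix complex_of_real A *v v = z *s v)"

definition A_Sigma :: "real \<Rightarrow> real \<Rightarrow> real \<Rightarrow> real \<Rightarrow> real \<Rightarrow> real^2^2" where
  "A_Sigma \<alpha> \<beta> \<gamma> \<zeta> \<epsilon> =
     - vector [vector [\<alpha> * \<epsilon> + \<zeta>, \<beta> * \<epsilon>],
               vector [2 * \<gamma>,     2 * \<zeta>]]"

definition p_Sigma :: "real \<Rightarrow> real^2" where
  "p_Sigma \<beta> = vector [2 * \<beta>, 0]"

definition q_Sigma :: "real \<Rightarrow> real^2" where
  "q_Sigma \<gamma> = vector [\<gamma>, 0]"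

definition B_Sigma :: "real \<Rightarrow> real \<Rightarrow> real \<Rightarrow> real \<Rightarrow> real \<Rightarrow> real^3^3" where
  "B_Sigma \<alpha> \<beta> \<gamma> \<zeta> \<epsilon> =
     vector [vector [2 * \<alpha>, 2 * \<beta>,     0],
             vector [\<gamma> / \<epsilon>, \<alpha> + \<zeta> / \<epsilon>, \<beta>],
             vector [0,     2 * \<gamma> / \<epsilon>, 2 * \<zeta> / \<epsilon>]]"

definition lambda_Sigma :: "real \<Rightarrow> real \<Rightarrow> real \<Rightarrow> real \<Rightarrow> real" where
  "lambda_Sigma \<alpha> \<beta> \<gamma> \<zeta> = 2 * (\<alpha> - \<beta> * \<gamma> / \<zeta>)"

definition lambda_Sigma_eps :: "real \<Rightarrow> real \<Rightarrow> real \<Rightarrow> real \<Rightarrow> real \<Rightarrow> real" where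
  "lambda_Sigma_eps \<alpha> \<beta> \<gamma> \<zeta> \<epsilon> =
     2 * \<alpha> + p_Sigma \<beta> \<bullet> (matrix_inv (A_Sigma \<alpha> \<beta> \<gamma> \<zeta> \<epsilon>) *v q_Sigma \<gamma>)"

definition fine_rhs ::
  "real \<Rightarrow> real \<Rightarrow> real \<Rightarrow> real \<Rightarrow> real \<Rightarrow> real \<Rightarrow> real^3 \<Rightarrow> real^3" where
  "fine_rhs \<alpha> \<beta> \<gamma> \<zeta> \<sigma> \<epsilon> S =
     B_Sigma \<alpha> \<beta> \<gamma> \<zeta> \<epsilon> *v S + vector [\<sigma>\<^sup>2, 0, \<sigma>\<^sup>2 / \<epsilon>]"

definition coarse_rhs ::
  "real \<Rightarrow> real \<Rightarrow> real \<Rightarrow> real \<Rightarrow> real \<Rightarrow> real \<Rightarrow> real" where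
  "coarse_rhs \<alpha> \<beta> \<gamma> \<zeta> \<sigma> X = lambda_Sigma \<alpha> \<beta> \<gamma> \<zeta> * X + \<sigma>\<^sup>2"

definition restrict_op :: "real^3 \<Rightarrow> real" where
  "restrict_op S = S $ 1"

definition match_op :: "real \<Rightarrow> real^3 \<Rightarrow> real^3" where
  "match_op X S = vector [X, S $ 2, S $ 3]"

definition lift_op :: "real^3 \<Rightarrow> real \<Rightarrow> real^3" where
  "lift_op S0 X = vector [X, S0 $ 2, S0 $ 3]"

(* Iterates with coarse propagator G, fine propagator F and initial value S0;
   the arguments k and n are the iteration number and the time index. *)
fun macro_iter :: "(real \<Rightarrow> real) \<Rightarrow> (real^3 \<Rightarrow> real^3) \<Rightarrow> real^3 \<Rightarrow> nat \<Rightarrow> nat \<Rightarrow> real"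
and micro_iter :: "(real \<Rightarrow> real) \<Rightarrow> (real^3 \<Rightarrow> real^3) \<Rightarrow> real^3 \<Rightarrow> nat \<Rightarrow> nat \<Rightarrow> real^3"
where
  "macro_iter G F S0 k 0 = S0 $ 1"
| "macro_iter G F S0 0 (Suc n) = G (macro_iter G F S0 0 n)"
| "macro_iter G F S0 (Suc k) (Suc n) =
     G (macro_iter G F S0 (Suc k) n) + restrict_op (F (micro_iter G F S0 k n))
       - G (macro_iter G F S0 k n)"
| "micro_iter G F S0 k 0 = S0"
| "micro_iter G F S0 0 (Suc n) = lift_op S0 (macro_iter G F S0 0 (Suc n))"
| "micro_iter G F S0 (Suc k) (Suc n) =
     match_op (macro_iter G F S0 (Suc k) (Suc n)) (F (micro_iter G F S0 k n))"

definition t_BL :: "real \<Rightarrow> real \<Rightarrow> real" where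
  "t_BL \<mu> \<epsilon> = 2 * \<epsilon> / \<mu> * ln (1 / \<epsilon>)"

end

theory Submission
  imports Defs
begin

text \<open>
  The eigenvalue condition forces \<open>\<zeta> < 0\<close>, by the trace of \<open>A\<^sub>\<Sigma>(\<epsilon>)\<close> as
  \<open>\<epsilon> \<rightarrow> 0\<close>. The variable \<open>\<Sigma>\<^sub>x - (2\<beta>/\<zeta>)\<epsilon>\<Sigma>\<^sub>x\<^sub>y\<close> solves the reduced equation up to
  \<open>O(\<epsilon>)\<close>, and the fast variables forget their initial values at the rate \<open>exp(\<zeta>t/\<epsilon>)\<close> and become
  slaved to \<open>\<Sigma>\<^sub>x\<close>. Over one time step the fine propagator thus acts on a
  perturbation \<open>(E, f)\<close> (slow and fast part) so that its first component agrees with the coarse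
  propagator up to \<open>O(\<epsilon>)(|E| + |f|)\<close> and its fast part is \<open>O(|E|) + O(\<epsilon>)|f|\<close>. The orders
  \<open>a\<^sub>k\<close>, \<open>b\<^sub>k\<close> of the macro and micro errors therefore satisfy \<open>a\<^sub>0 = 1\<close>, \<open>b\<^sub>0 = 0\<close>,
  \<open>a\<^sub>k\<^sub>+\<^sub>1 = 1 + min a\<^sub>k b\<^sub>k\<close>, \<open>b\<^sub>k\<^sub>+\<^sub>1 = min a\<^sub>k (1 + b\<^sub>k)\<close>.
  As the constant may depend on \<open>\<Delta>t\<close>, the bound \<open>exp(\<zeta>\<Delta>t/\<epsilon>) \<le> \<epsilon>/(|\<zeta>|\<Delta>t)\<close> suffices for the
  decay over one step.
\<close>

section \<open>Scalar linear equations with bounded forcing\<close>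

text \<open>Variation of constants with the integrating factor \<open>exp (- (a * r))\<close>: the
  derivative of \<open>f\<close> is dominated by that of \<open>\<phi>\<close>, hence so is its
  increment. The factor \<open>(exp (a * t) - 1) / a\<close> is the integral of
  \<open>exp (a * r)\<close> over \<open>{0..t}\<close>.\<close>

lemma linear_ode_bound:
  fixes y g :: "real \<Rightarrow> real"
  assumes a: "a \<noteq> 0" and t: "t \<in> {0..h}"
    and y: "\<And>r. r \<in> {0..h} \<Longrightarrow> (y has_real_derivative a * y r + g r) (at r within {0..h})"
    and g: "\<And>r. r \<in> {0..h} \<Longrightarrow> \<bar>g r\<bar> \<le> G"
  shows "\<bar>y t - exp (a * t) * y 0\<bar> \<le> G * ((exp (a * t) - 1) / a)"
proof (cases "t = 0")
  case False
  define f where "f = (\<lambda>r. exp (- (a * r)) * y r)"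
  define \<phi> where "\<phi> = (\<lambda>r. - G * exp (- (a * r)) / a)"
  have f: "(f has_real_derivative exp (- (a * r)) * g r) (at r within {0..h})"
    if "r \<in> {0..h}" for r
    unfolding f_def
    by (rule derivative_eq_intros y that refl | simp add: algebra_simps)+
  have \<phi>: "(\<phi> has_real_derivative G * exp (- (a * r))) (at r)" for r
    unfolding \<phi>_def using a by (auto intro!: derivative_eq_intros)
  have "norm (f t - f 0) \<le> \<phi> t - \<phi> 0"
  proof (rule differentiable_bound_general)
    show "0 < t" using t False by auto
    have "continuous_on {0..h} f"
      using f by (meson DERIV_continuous continuous_on_eq_continuous_within)
    then show "continuous_on {0..t} f"
      using t by (auto elim: continuous_on_subset)
    show "continuous_on {0..t} \<phi>"
      unfolding \<phi>_def using a by (intro continuous_intros) auto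
    fix r assume r: "0 < r" "r < t"
    have "at r within {0..h} = at r"
      by (rule at_within_interior) (use r t in auto)
    then show "(f has_vector_derivative exp (- (a * r)) * g r) (at r)"
      using f[of r] r t by (simp add: has_real_derivative_iff_has_vector_derivative)
    show "(\<phi> has_vector_derivative G * exp (- (a * r))) (at r)"
      using \<phi> by (simp add: has_real_derivative_iff_has_vector_derivative)
    show "norm (exp (- (a * r)) * g r) \<le> G * exp (- (a * r))"
      using g[of r] r t by (simp add: abs_mult mult.commute)
  qed
  then have "exp (a * t) * \<bar>exp (- (a * t)) * y t - y 0\<bar>
      \<le> exp (a * t) * (G * (1 - exp (- (a * t))) / a)"
    by (intro mult_left_mono) (auto simp: f_def \<phi>_def algebra_simps diff_divide_distrib)
  moreover have "exp (a * t) * \<bar>exp (- (a * t)) * y t - y 0\<bar> = \<bar>y t - exp (a * t) * y 0\<bar>"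
  proof -
    have "\<bar>y t - exp (a * t) * y 0\<bar> = \<bar>exp (a * t) * (exp (- (a * t)) * y t - y 0)\<bar>"
      by (simp add: right_diff_distrib exp_minus flip: mult.assoc)
    then show ?thesis by (simp only: abs_mult abs_exp_cancel)
  qed
  moreover have "exp (a * t) * (G * (1 - exp (- (a * t))) / a) = G * ((exp (a * t) - 1) / a)"
    using a by (simp add: exp_minus field_simps)
  ultimately show ?thesis by linarith
qed auto

text \<open>Makes the two factors of \<open>linear_ode_bound\<close> uniform over
  \<open>{0..T}\<close> for rates of either sign, as the reduced rate \<open>lambda_Sigma\<close>
  may be positive or negative.\<close>

lemma exp_integral_bound:
  fixes a t T :: real
  assumes "a \<noteq> 0" "0 \<le> t" "t \<le> T"
  shows "exp (a * t) \<le> exp (\<bar>a\<bar> * T)" "0 \<le> (exp (a * t) - 1) / a"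
    "(exp (a * t) - 1) / a \<le> exp (\<bar>a\<bar> * T) / \<bar>a\<bar>"
proof -
  have at: "a * t \<le> \<bar>a\<bar> * T" using assms by (intro mult_mono) auto
  then show "exp (a * t) \<le> exp (\<bar>a\<bar> * T)" by simp
  show "0 \<le> (exp (a * t) - 1) / a"
    using assms by (cases "a > 0") (auto simp: zero_le_divide_iff mult_nonpos_nonneg)
  show "(exp (a * t) - 1) / a \<le> exp (\<bar>a\<bar> * T) / \<bar>a\<bar>"
  proof (cases "a > 0")
    case True
    have "exp (a * t) - 1 \<le> exp (\<bar>a\<bar> * T)" using exp_le_cancel_iff[THEN iffD2, OF at] by linarith
    then show ?thesis using True by (simp add: divide_right_mono)
  next
    case False
    have "1 - exp (a * t) \<le> exp (\<bar>a\<bar> * T)"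
      using one_le_exp_iff[of "\<bar>a\<bar> * T"] assms by (smt (verit) exp_gt_zero mult_nonneg_nonneg)
    then have "(1 - exp (a * t)) / \<bar>a\<bar> \<le> exp (\<bar>a\<bar> * T) / \<bar>a\<bar>" by (rule divide_right_mono) simp
    moreover have "(1 - exp (a * t)) / \<bar>a\<bar> = (exp (a * t) - 1) / a"
      using False assms by (simp add: field_simps)
    ultimately show ?thesis by simp
  qed
qed

text \<open>For a negative rate the integral of \<open>exp (a * r)\<close> is at most
  \<open>1 / \<bar>a\<bar>\<close> on intervals of any length. With
  \<open>a = \<zeta> / \<epsilon>\<close>, a forcing of size \<open>1 / \<epsilon>\<close> therefore
  contributes only O(1).\<close>

lemma stable_linear_ode_bound:
  fixes y g :: "real \<Rightarrow> real"
  assumes a: "a < 0" and t: "t \<in> {0..h}"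
    and y: "\<And>r. r \<in> {0..h} \<Longrightarrow> (y has_real_derivative a * y r + g r) (at r within {0..h})"
    and g: "\<And>r. r \<in> {0..h} \<Longrightarrow> \<bar>g r\<bar> \<le> G"
  shows "\<bar>y t\<bar> \<le> exp (a * t) * \<bar>y 0\<bar> + G / \<bar>a\<bar>"
proof -
  have "\<bar>y t - exp (a * t) * y 0\<bar> \<le> G * ((exp (a * t) - 1) / a)"
    by (rule linear_ode_bound[OF _ t y g]) (use a in auto)
  also have "\<dots> \<le> G * (1 / \<bar>a\<bar>)"
  proof (rule mult_left_mono)
    show "0 \<le> G" using g[OF t] by simp
    show "(exp (a * t) - 1) / a \<le> 1 / \<bar>a\<bar>" using a by (simp add: field_simps mult_nonpos_nonneg)
  qed
  finally have "\<bar>y t - exp (a * t) * y 0\<bar> \<le> G / \<bar>a\<bar>" by simp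
  moreover have "\<bar>y t\<bar> \<le> \<bar>y t - exp (a * t) * y 0\<bar> + \<bar>exp (a * t) * y 0\<bar>" by linarith
  ultimately show ?thesis by (simp add: abs_mult)
qed

section \<open>Sign of \<zeta> from the spectrum\<close>

text \<open>The trace is \<open>- (\<alpha> * \<epsilon> + 3 * \<zeta>)\<close>, and one eigenvalue
  has real part at most half of it: the root of the characteristic polynomial with the principal
  square root subtracted, since that square root has nonnegative real part.\<close>

lemma trace_bounded_below:
  assumes ev: "\<And>z. complex_eigenvalue (A_Sigma \<alpha> \<beta> \<gamma> \<zeta> \<epsilon>) z \<Longrightarrow> \<mu> \<le> Re z"
    and b: "\<beta> * \<epsilon> \<noteq> 0"
  shows "2 * \<mu> \<le> - (\<alpha> * \<epsilon> + 3 * \<zeta>)"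
proof -
  define a b c d where "a = complex_of_real (- (\<alpha> * \<epsilon> + \<zeta>))"
    and "b = complex_of_real (- (\<beta> * \<epsilon>))" and "c = complex_of_real (- (2 * \<gamma>))"
    and "d = complex_of_real (- (2 * \<zeta>))"
  define s where "s = csqrt ((a + d)\<^sup>2 - 4 * (a * d - b * c))"
  define z where "z = (a + d - s) / 2"
  have s2: "s * s = (a + d)\<^sup>2 - 4 * (a * d - b * c)"
    unfolding s_def by (simp flip: power2_eq_square)
  have z2: "z * z = (a + d) * z - (a * d - b * c)"
    using s2 unfolding z_def by (simp add: field_simps power2_eq_square)
  have "complex_eigenvalue (A_Sigma \<alpha> \<beta> \<gamma> \<zeta> \<epsilon>) z"
    unfolding complex_eigenvalue_def
  proof (intro exI conjI)
    \<comment> \<open>The first row of the eigenvalue equation holds identically, the second is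
      \<open>z2\<close>; the vector is nonzero because \<open>b \<noteq> 0\<close>.\<close>
    let ?v = "vector [b, z - a] :: complex^2"
    have "?v $ 1 \<noteq> 0 $ 1" using b by (simp add: b_def)
    then show "?v \<noteq> 0" by metis
    show "map_matrix complex_of_real (A_Sigma \<alpha> \<beta> \<gamma> \<zeta> \<epsilon>) *v ?v = z *s ?v"
      using z2
      by (simp add: vec_eq_iff forall_2 matrix_vector_mult_def sum_2 map_matrix_def A_Sigma_def)
        (simp add: a_def b_def c_def d_def algebra_simps)
  qed
  then have "\<mu> \<le> Re z" by (rule ev)
  moreover have "0 \<le> Re s" using csqrt_principal[of "(a + d)\<^sup>2 - 4 * (a * d - b * c)"] by (auto simp: s_def)
  moreover have "Re z = (- (\<alpha> * \<epsilon> + 3 * \<zeta>) - Re s) / 2"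
    by (simp add: z_def a_def d_def)
  ultimately show ?thesis by simp
qed

text \<open>For \<open>\<beta> = 0\<close> the matrix is lower triangular and
  \<open>- 2 * \<zeta>\<close> is itself an eigenvalue. Otherwise the trace bound is applied at a
  small \<epsilon>.\<close>

lemma zeta_negative:
  assumes \<mu>: "\<mu> > 0"
    and ev: "\<forall>\<epsilon>\<in>{0<..<1}. \<forall>z. complex_eigenvalue (A_Sigma \<alpha> \<beta> \<gamma> \<zeta> \<epsilon>) z \<longrightarrow> \<mu> \<le> Re z"
  shows "\<zeta> < 0"
proof (cases "\<beta> = 0")
  case True
  have "complex_eigenvalue (A_Sigma \<alpha> \<beta> \<gamma> \<zeta> (1/2)) (complex_of_real (- 2 * \<zeta>))"
    unfolding complex_eigenvalue_def
  proof (intro exI conjI)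
    let ?v = "vector [0, 1] :: complex^2"
    have "?v $ 2 \<noteq> 0 $ 2" by simp
    then show "?v \<noteq> 0" by metis
    show "map_matrix complex_of_real (A_Sigma \<alpha> \<beta> \<gamma> \<zeta> (1/2)) *v ?v
        = complex_of_real (- 2 * \<zeta>) *s ?v"
      by (simp add: True vec_eq_iff forall_2 matrix_vector_mult_def sum_2 map_matrix_def A_Sigma_def)
  qed
  moreover have "(1/2::real) \<in> {0<..<1}" by simp
  ultimately have "\<mu> \<le> Re (complex_of_real (- 2 * \<zeta>))"
    using ev by blast
  then show ?thesis using \<mu> by simp
next
  case False
  \<comment> \<open>Small enough for \<open>\<bar>\<alpha> * \<epsilon>\<bar> \<le> \<mu>\<close>;
    the trace bound then leaves \<open>3 * \<zeta> \<le> - \<mu>\<close>.\<close>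
  define \<epsilon> where "\<epsilon> = min (1/2) (\<mu> / (\<bar>\<alpha>\<bar> + 1))"
  have \<epsilon>: "\<epsilon> \<in> {0<..<1}" using \<mu> by (auto simp: \<epsilon>_def)
  have "2 * \<mu> \<le> - (\<alpha> * \<epsilon> + 3 * \<zeta>)"
    by (rule trace_bounded_below[where \<beta>=\<beta> and \<gamma>=\<gamma>]) (use ev \<epsilon> False in auto)
  moreover have "\<bar>\<alpha> * \<epsilon>\<bar> \<le> \<mu>"
  proof -
    have "\<bar>\<alpha> * \<epsilon>\<bar> \<le> (\<bar>\<alpha>\<bar> + 1) * (\<mu> / (\<bar>\<alpha>\<bar> + 1))"
      unfolding abs_mult by (rule mult_mono) (use \<epsilon> in \<open>auto simp: \<epsilon>_def\<close>)
    then show ?thesis by (simp add: abs_mult)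
  qed
  ultimately show ?thesis using \<mu> by linarith
qed

section \<open>Slow and fast components of the covariance flow\<close>

text \<open>The multiscale equation in components, with \<open>x\<close>, \<open>u\<close>,
  \<open>v\<close> for \<open>\<Sigma>\<^sub>x\<close>, \<open>\<Sigma>\<^sub>x\<^sub>y\<close>,
  \<open>\<Sigma>\<^sub>y\<close>. The source \<open>s\<close> is a parameter so that differences of
  solutions, for which \<open>s = 0\<close>, are covered too.\<close>

definition covariance_flow ::
  "real \<Rightarrow> real \<Rightarrow> real \<Rightarrow> real \<Rightarrow> real \<Rightarrow> real \<Rightarrow> real \<Rightarrow>
   (real \<Rightarrow> real) \<Rightarrow> (real \<Rightarrow> real) \<Rightarrow> (real \<Rightarrow> real) \<Rightarrow> bool" where
  "covariance_flow \<alpha> \<beta> \<gamma> \<zeta> \<epsilon> s h x u v \<longleftrightarrow> (\<forall>t\<in>{0..h}.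
     (x has_real_derivative 2 * \<alpha> * x t + 2 * \<beta> * u t + s) (at t within {0..h}) \<and>
     (u has_real_derivative \<gamma> / \<epsilon> * x t + (\<alpha> + \<zeta> / \<epsilon>) * u t + \<beta> * v t) (at t within {0..h}) \<and>
     (v has_real_derivative 2 * \<gamma> / \<epsilon> * u t + 2 * \<zeta> / \<epsilon> * v t + s / \<epsilon>) (at t within {0..h}))"

text \<open>Eliminating \<open>u\<close> from the first equation by means of the second shows that
  \<open>w = x - (2\<beta>/\<zeta>)\<epsilon>u\<close> solves the reduced equation up to \<open>O(\<epsilon>)\<close>.\<close>

lemma slow_component_bound:
  fixes \<alpha> \<beta> \<gamma> \<zeta> T :: real and X :: "real \<Rightarrow> real"
  defines "\<kappa> \<equiv> lambda_Sigma \<alpha> \<beta> \<gamma> \<zeta>" and "d \<equiv> 2 * \<beta> / \<zeta>"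
  defines "L \<equiv> exp (\<bar>\<kappa>\<bar> * T) * (1 + 1 / \<bar>\<kappa>\<bar>)"
  assumes \<zeta>: "\<zeta> < 0" and \<kappa>: "\<kappa> \<noteq> 0" and \<epsilon>: "\<epsilon> > 0"
    and t: "t \<in> {0..h}" and hT: "h \<le> T"
    and flow: "covariance_flow \<alpha> \<beta> \<gamma> \<zeta> \<epsilon> s h x u v"
    and Q: "\<And>r. r \<in> {0..h} \<Longrightarrow> \<bar>u r\<bar> + \<bar>v r\<bar> \<le> Q"
    and X: "\<And>r. r \<in> {0..h} \<Longrightarrow> (X has_real_derivative \<kappa> * X r + s') (at r within {0..h})"
  shows "\<bar>x t - X t\<bar> \<le> L * (\<bar>x 0 - X 0\<bar> + \<bar>s - s'\<bar>)
    + (L * (\<bar>d\<bar> + \<bar>d\<bar> * (\<bar>\<kappa>\<bar> + \<bar>\<alpha>\<bar> + \<bar>\<beta>\<bar>)) + \<bar>d\<bar>) * (\<epsilon> * Q)"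
proof -
  define k where "k = \<bar>d\<bar> * (\<bar>\<kappa>\<bar> + \<bar>\<alpha>\<bar> + \<bar>\<beta>\<bar>)"
  \<comment> \<open>\<open>y\<close> is the corrected slow variable minus the comparison solution
    \<open>X\<close>. Its equation has the rate \<kappa> and the forcing \<open>g\<close>, made of
    the gap between the sources and an O(\<epsilon>) remainder.\<close>
  define y where "y = (\<lambda>r. x r - d * \<epsilon> * u r - X r)"
  define g where "g = (\<lambda>r. (s - s') + \<epsilon> * d * (\<kappa> * u r - \<alpha> * u r - \<beta> * v r))"
  have u: "\<bar>u r\<bar> \<le> Q" "\<bar>v r\<bar> \<le> Q" if "r \<in> {0..h}" for r
    using Q[OF that] by auto
  have Q0: "0 \<le> Q" using u[OF t] by linarith
  have g: "\<bar>g r\<bar> \<le> \<bar>s - s'\<bar> + k * (\<epsilon> * Q)" if "r \<in> {0..h}" for r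
  proof -
    have "\<bar>\<kappa> * u r - \<alpha> * u r - \<beta> * v r\<bar> \<le> \<bar>\<kappa> * u r\<bar> + \<bar>\<alpha> * u r\<bar> + \<bar>\<beta> * v r\<bar>" by linarith
    also have "\<dots> \<le> \<bar>\<kappa>\<bar> * Q + \<bar>\<alpha>\<bar> * Q + \<bar>\<beta>\<bar> * Q"
      unfolding abs_mult using u[OF that] by (intro add_mono mult_left_mono) auto
    finally have "\<bar>\<epsilon> * d * (\<kappa> * u r - \<alpha> * u r - \<beta> * v r)\<bar>
        \<le> \<epsilon> * \<bar>d\<bar> * (\<bar>\<kappa>\<bar> * Q + \<bar>\<alpha>\<bar> * Q + \<bar>\<beta>\<bar> * Q)"
      using \<epsilon> by (simp add: abs_mult mult_left_mono)
    then show ?thesis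
      unfolding g_def k_def by (intro order.trans[OF abs_triangle_ineq]) (simp add: algebra_simps)
  qed
  have y: "(y has_real_derivative \<kappa> * y r + g r) (at r within {0..h})" if "r \<in> {0..h}" for r
  proof -
    have "(y has_real_derivative (2 * \<alpha> * x r + 2 * \<beta> * u r + s)
        - d * \<epsilon> * (\<gamma> / \<epsilon> * x r + (\<alpha> + \<zeta> / \<epsilon>) * u r + \<beta> * v r) - (\<kappa> * X r + s')) (at r within {0..h})"
      unfolding y_def using flow that X[OF that] unfolding covariance_flow_def
      by (intro DERIV_diff DERIV_cmult) auto
    \<comment> \<open>With \<open>d = 2 * \<beta> / \<zeta>\<close> the term
      \<open>d * \<zeta> * u\<close> removes \<open>2 * \<beta> * u\<close>, and
      \<open>d * \<gamma> * x\<close> turns the coefficient \<open>2 * \<alpha>\<close> into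
      \<kappa>; no factor \<open>1 / \<epsilon>\<close> survives.\<close>
    moreover have "(2 * \<alpha> * x r + 2 * \<beta> * u r + s)
        - d * \<epsilon> * (\<gamma> / \<epsilon> * x r + (\<alpha> + \<zeta> / \<epsilon>) * u r + \<beta> * v r) - (\<kappa> * X r + s') = \<kappa> * y r + g r"
      using \<epsilon> \<zeta> unfolding y_def g_def d_def \<kappa>_def lambda_Sigma_def by (simp add: field_simps)
    ultimately show ?thesis by (simp only:)
  qed
  \<comment> \<open>\<open>L\<close> majorizes both the growth factor and its integral, so one
    constant serves for the initial value and for the forcing.\<close>
  have L: "exp (\<kappa> * t) \<le> L" "0 \<le> (exp (\<kappa> * t) - 1) / \<kappa>" "(exp (\<kappa> * t) - 1) / \<kappa> \<le> L" "0 \<le> L"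
  proof -
    have t': "0 \<le> t" "t \<le> T" using t hT by auto
    note b = exp_integral_bound[OF \<kappa> t']
    have "0 \<le> exp (\<bar>\<kappa>\<bar> * T) / \<bar>\<kappa>\<bar>" by simp
    moreover have "L = exp (\<bar>\<kappa>\<bar> * T) + exp (\<bar>\<kappa>\<bar> * T) / \<bar>\<kappa>\<bar>" by (simp add: L_def algebra_simps)
    moreover have "0 < exp (\<bar>\<kappa>\<bar> * T)" by simp
    ultimately show "exp (\<kappa> * t) \<le> L" "0 \<le> (exp (\<kappa> * t) - 1) / \<kappa>" "(exp (\<kappa> * t) - 1) / \<kappa> \<le> L" "0 \<le> L"
      using b by linarith+
  qed
  have G0: "0 \<le> \<bar>s - s'\<bar> + k * (\<epsilon> * Q)" using g[OF t] by linarith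
  have du: "\<bar>d * \<epsilon> * u r\<bar> \<le> \<bar>d\<bar> * (\<epsilon> * Q)" if "r \<in> {0..h}" for r
    using u(1)[OF that] \<epsilon> by (simp add: abs_mult mult_left_mono mult.assoc)
  have "\<bar>y t - exp (\<kappa> * t) * y 0\<bar> \<le> (\<bar>s - s'\<bar> + k * (\<epsilon> * Q)) * ((exp (\<kappa> * t) - 1) / \<kappa>)"
    by (rule linear_ode_bound[OF \<kappa> t y g])
  also have "\<dots> \<le> (\<bar>s - s'\<bar> + k * (\<epsilon> * Q)) * L" by (rule mult_left_mono[OF L(3) G0])
  finally have 1: "\<bar>y t - exp (\<kappa> * t) * y 0\<bar> \<le> (\<bar>s - s'\<bar> + k * (\<epsilon> * Q)) * L" .
  \<comment> \<open>The correction \<open>d * \<epsilon> * u\<close> is paid for twice: in passing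
    from \<open>x\<close> to \<open>y\<close> at time 0 and back at time \<open>t\<close>.\<close>
  have "\<bar>y 0\<bar> \<le> \<bar>x 0 - X 0\<bar> + \<bar>d\<bar> * (\<epsilon> * Q)"
    using du[of 0] t unfolding y_def by auto
  then have 2: "\<bar>exp (\<kappa> * t) * y 0\<bar> \<le> L * (\<bar>x 0 - X 0\<bar> + \<bar>d\<bar> * (\<epsilon> * Q))"
    unfolding abs_mult using L by (intro mult_mono) auto
  have "\<bar>x t - X t\<bar> \<le> \<bar>y t\<bar> + \<bar>d\<bar> * (\<epsilon> * Q)" using du[OF t] unfolding y_def by linarith
  moreover have "\<bar>y t\<bar> \<le> \<bar>y t - exp (\<kappa> * t) * y 0\<bar> + \<bar>exp (\<kappa> * t) * y 0\<bar>" by linarith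
  ultimately have "\<bar>x t - X t\<bar> \<le> (\<bar>s - s'\<bar> + k * (\<epsilon> * Q)) * L
      + L * (\<bar>x 0 - X 0\<bar> + \<bar>d\<bar> * (\<epsilon> * Q)) + \<bar>d\<bar> * (\<epsilon> * Q)"
    using 1 2 by linarith
  then show ?thesis unfolding k_def[symmetric] by (simp add: algebra_simps)
qed

text \<open>The combination \<open>z = v + (2\<gamma>/\<zeta>)u\<close> decouples the two fast components up to \<open>O(\<epsilon>)\<close>.\<close>

lemma fast_components_bound:
  fixes \<gamma> \<zeta> :: real
  defines "c \<equiv> 2 * \<gamma> / \<zeta>"
  assumes \<zeta>: "\<zeta> < 0" and \<epsilon>: "\<epsilon> > 0" and t: "t \<in> {0..h}"
    and flow: "covariance_flow \<alpha> \<beta> \<gamma> \<zeta> \<epsilon> s h x u v"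
    and Q: "\<And>r. r \<in> {0..h} \<Longrightarrow> \<bar>u r\<bar> + \<bar>v r\<bar> \<le> Q"
    and P: "\<And>r. r \<in> {0..h} \<Longrightarrow> \<bar>x r\<bar> \<le> P"
  shows "\<bar>u t\<bar> + \<bar>v t\<bar> \<le> (1 + 2 * \<bar>c\<bar>) * (exp (\<zeta> / \<epsilon> * t) * (\<bar>u 0\<bar> + \<bar>v 0\<bar>))
    + (1 + 2 * \<bar>c\<bar>) / \<bar>\<zeta>\<bar> * (\<bar>\<gamma>\<bar> * P + (\<bar>\<alpha>\<bar> + \<bar>\<beta>\<bar>) * (\<epsilon> * Q) + \<bar>s\<bar>)"
proof -
  \<comment> \<open>\<open>H / \<epsilon>\<close> will bound the forcing of the \<open>u\<close>
    equation; its \<open>1 / \<epsilon>\<close> cancels against the decay rate.\<close>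
  define H where "H = \<bar>\<gamma>\<bar> * P + (\<bar>\<alpha>\<bar> + \<bar>\<beta>\<bar>) * (\<epsilon> * Q)"
  define z where "z = (\<lambda>r. v r + c * u r)"
  define f where "f = (\<lambda>r. \<gamma> / \<epsilon> * x r + \<alpha> * u r + \<beta> * v r)"
  define e where "e = exp (\<zeta> / \<epsilon> * t)"
  have uv: "\<bar>u r\<bar> \<le> Q" "\<bar>v r\<bar> \<le> Q" if "r \<in> {0..h}" for r
    using Q[OF that] by auto
  have f: "\<bar>f r\<bar> \<le> H / \<epsilon>" if r: "r \<in> {0..h}" for r
  proof -
    have "\<bar>f r\<bar> \<le> \<bar>\<gamma> / \<epsilon> * x r\<bar> + \<bar>\<alpha> * u r\<bar> + \<bar>\<beta> * v r\<bar>" unfolding f_def by linarith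
    also have "\<dots> \<le> \<bar>\<gamma> / \<epsilon>\<bar> * P + \<bar>\<alpha>\<bar> * Q + \<bar>\<beta>\<bar> * Q"
      unfolding abs_mult using uv[OF r] P[OF r] by (intro add_mono mult_left_mono) auto
    also have "\<dots> = H / \<epsilon>" unfolding H_def using \<epsilon> by (simp add: field_simps)
    finally show ?thesis .
  qed
  have H0: "0 \<le> H" using f[OF t] \<epsilon> by (smt (verit) divide_less_0_iff)
  have u': "(u has_real_derivative \<zeta> / \<epsilon> * u r + f r) (at r within {0..h})"
    if r: "r \<in> {0..h}" for r
    using flow r unfolding covariance_flow_def f_def by (simp add: algebra_simps)
  have "\<bar>u t\<bar> \<le> exp (\<zeta> / \<epsilon> * t) * \<bar>u 0\<bar> + (H / \<epsilon>) / \<bar>\<zeta> / \<epsilon>\<bar>"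
    by (rule stable_linear_ode_bound[OF _ t u' f]) (use \<zeta> \<epsilon> in \<open>auto simp: divide_neg_pos\<close>)
  then have 1: "\<bar>u t\<bar> \<le> e * \<bar>u 0\<bar> + H / \<bar>\<zeta>\<bar>" using \<epsilon> by (simp add: e_def)
  have z': "(z has_real_derivative 2 * \<zeta> / \<epsilon> * z r + (s / \<epsilon> + c * f r)) (at r within {0..h})"
    if r: "r \<in> {0..h}" for r
  proof -
    have "(z has_real_derivative (2 * \<gamma> / \<epsilon> * u r + 2 * \<zeta> / \<epsilon> * v r + s / \<epsilon>)
        + c * (\<zeta> / \<epsilon> * u r + f r)) (at r within {0..h})"
      unfolding z_def using flow u'[OF r] r unfolding covariance_flow_def
      by (intro DERIV_add DERIV_cmult) auto
    \<comment> \<open>By the choice of \<open>c\<close> the terms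
      \<open>2 * \<gamma> / \<epsilon> * u\<close> and \<open>c * \<zeta> / \<epsilon> * u\<close>
      are equal and add up to \<open>2 * \<zeta> / \<epsilon> * (c * u)\<close>, just what decay of
      \<open>z\<close> at the rate of \<open>v\<close> demands.\<close>
    moreover have "(2 * \<gamma> / \<epsilon> * u r + 2 * \<zeta> / \<epsilon> * v r + s / \<epsilon>) + c * (\<zeta> / \<epsilon> * u r + f r)
        = 2 * \<zeta> / \<epsilon> * z r + (s / \<epsilon> + c * f r)"
      using \<epsilon> \<zeta> unfolding z_def c_def by (simp add: field_simps)
    ultimately show ?thesis by (simp only:)
  qed
  have cf: "\<bar>s / \<epsilon> + c * f r\<bar> \<le> (\<bar>s\<bar> + \<bar>c\<bar> * H) / \<epsilon>" if r: "r \<in> {0..h}" for r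
  proof -
    have "\<bar>s / \<epsilon> + c * f r\<bar> \<le> \<bar>s / \<epsilon>\<bar> + \<bar>c\<bar> * \<bar>f r\<bar>"
      unfolding abs_mult[symmetric] by (rule abs_triangle_ineq)
    also have "\<dots> \<le> \<bar>s / \<epsilon>\<bar> + \<bar>c\<bar> * (H / \<epsilon>)"
      by (intro add_left_mono mult_left_mono f[OF r]) simp
    also have "\<dots> = (\<bar>s\<bar> + \<bar>c\<bar> * H) / \<epsilon>" using \<epsilon> by (simp add: add_divide_distrib)
    finally show ?thesis .
  qed
  have "\<bar>z t\<bar> \<le> exp (2 * \<zeta> / \<epsilon> * t) * \<bar>z 0\<bar> + ((\<bar>s\<bar> + \<bar>c\<bar> * H) / \<epsilon>) / \<bar>2 * \<zeta> / \<epsilon>\<bar>"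
    by (rule stable_linear_ode_bound[OF _ t z' cf]) (use \<zeta> \<epsilon> in \<open>auto simp: divide_neg_pos\<close>)
  moreover have "((\<bar>s\<bar> + \<bar>c\<bar> * H) / \<epsilon>) / \<bar>2 * \<zeta> / \<epsilon>\<bar> \<le> (\<bar>s\<bar> + \<bar>c\<bar> * H) / \<bar>\<zeta>\<bar>"
  proof -
    have "((\<bar>s\<bar> + \<bar>c\<bar> * H) / \<epsilon>) / \<bar>2 * \<zeta> / \<epsilon>\<bar> = ((\<bar>s\<bar> + \<bar>c\<bar> * H) / \<bar>\<zeta>\<bar>) / 2"
      using \<epsilon> \<zeta> by (simp add: abs_mult field_simps)
    also have "\<dots> \<le> (\<bar>s\<bar> + \<bar>c\<bar> * H) / \<bar>\<zeta>\<bar>"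
      using H0 \<zeta> by (simp add: divide_le_eq)
    finally show ?thesis .
  qed
  moreover have "exp (2 * \<zeta> / \<epsilon> * t) * \<bar>z 0\<bar> \<le> e * (\<bar>v 0\<bar> + \<bar>c\<bar> * \<bar>u 0\<bar>)"
  proof (rule mult_mono)
    \<comment> \<open>\<open>z\<close> decays at twice the rate of \<open>u\<close>; as the exponent
      is nonpositive, its decay factor is at most \<open>e\<close>.\<close>
    have "2 * \<zeta> / \<epsilon> * t = \<zeta> / \<epsilon> * t + \<zeta> / \<epsilon> * t" by simp
    moreover have "\<zeta> / \<epsilon> * t \<le> 0"
      using \<zeta> \<epsilon> t by (intro mult_nonpos_nonneg) (auto simp: divide_nonpos_pos)
    ultimately show "exp (2 * \<zeta> / \<epsilon> * t) \<le> e" unfolding e_def exp_le_cancel_iff by linarith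
    show "\<bar>z 0\<bar> \<le> \<bar>v 0\<bar> + \<bar>c\<bar> * \<bar>u 0\<bar>" unfolding z_def by (simp add: abs_mult[symmetric])
  qed (auto simp: e_def)
  ultimately have 2: "\<bar>z t\<bar> \<le> e * (\<bar>v 0\<bar> + \<bar>c\<bar> * \<bar>u 0\<bar>) + (\<bar>s\<bar> + \<bar>c\<bar> * H) / \<bar>\<zeta>\<bar>"
    by linarith
  \<comment> \<open>Returning from \<open>z\<close> to \<open>v = z - c * u\<close> costs one
    \<open>\<bar>c\<bar>\<close>, the initial value and the forcing of \<open>z\<close> another,
    whence \<open>1 + 2 * \<bar>c\<bar>\<close>.\<close>
  have "\<bar>v t\<bar> \<le> \<bar>z t\<bar> + \<bar>c\<bar> * \<bar>u t\<bar>" unfolding z_def abs_mult[symmetric] by linarith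
  then have "\<bar>u t\<bar> + \<bar>v t\<bar> \<le> (1 + \<bar>c\<bar>) * \<bar>u t\<bar> + \<bar>z t\<bar>" by (simp add: algebra_simps)
  also have "\<dots> \<le> (1 + \<bar>c\<bar>) * (e * \<bar>u 0\<bar> + H / \<bar>\<zeta>\<bar>)
      + (e * (\<bar>v 0\<bar> + \<bar>c\<bar> * \<bar>u 0\<bar>) + (\<bar>s\<bar> + \<bar>c\<bar> * H) / \<bar>\<zeta>\<bar>)"
    by (intro add_mono mult_left_mono 1 2) simp
  also have "\<dots> = e * ((1 + 2 * \<bar>c\<bar>) * \<bar>u 0\<bar> + \<bar>v 0\<bar>) + ((1 + 2 * \<bar>c\<bar>) * H + \<bar>s\<bar>) / \<bar>\<zeta>\<bar>"
    by (simp add: algebra_simps add_divide_distrib)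
  also have "\<dots> \<le> e * ((1 + 2 * \<bar>c\<bar>) * (\<bar>u 0\<bar> + \<bar>v 0\<bar>)) + ((1 + 2 * \<bar>c\<bar>) * (H + \<bar>s\<bar>)) / \<bar>\<zeta>\<bar>"
    by (intro add_mono mult_left_mono divide_right_mono) (auto simp: e_def algebra_simps)
  finally show ?thesis unfolding H_def e_def by (simp add: algebra_simps add_divide_distrib)
qed

text \<open>Inserting the slow bound as \<open>P\<close> into the fast bound eliminates
  \<open>x\<close>. What stays implicit is \<open>Q\<close>, a bound on the fast components
  themselves, but it carries a factor \<epsilon>. As \<open>k\<close> is fixed before \<epsilon>,
  \<open>h\<close> and \<open>s\<close>, it depends on the coefficients and \<open>T\<close>
  only.\<close>

lemma flow_implicit_bounds:
  fixes \<alpha> \<beta> \<gamma> \<zeta> T :: real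
  assumes \<zeta>: "\<zeta> < 0" and \<kappa>: "lambda_Sigma \<alpha> \<beta> \<gamma> \<zeta> \<noteq> 0"
  obtains k where "k \<ge> 1"
    and "\<And>\<epsilon> h s x u v Q t. \<lbrakk>\<epsilon> > 0; h \<le> T; covariance_flow \<alpha> \<beta> \<gamma> \<zeta> \<epsilon> s h x u v;
          \<And>r. r \<in> {0..h} \<Longrightarrow> \<bar>u r\<bar> + \<bar>v r\<bar> \<le> Q; t \<in> {0..h}\<rbrakk>
        \<Longrightarrow> \<bar>x t\<bar> \<le> k * (\<bar>x 0\<bar> + \<bar>s\<bar> + \<epsilon> * Q) \<and>
          \<bar>u t\<bar> + \<bar>v t\<bar> \<le> k * (exp (\<zeta> / \<epsilon> * t) * (\<bar>u 0\<bar> + \<bar>v 0\<bar>) + \<bar>x 0\<bar> + \<bar>s\<bar> + \<epsilon> * Q)"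
    and "\<And>\<epsilon> h s x u v Q X t. \<lbrakk>\<epsilon> > 0; h \<le> T; covariance_flow \<alpha> \<beta> \<gamma> \<zeta> \<epsilon> s h x u v;
          \<And>r. r \<in> {0..h} \<Longrightarrow> \<bar>u r\<bar> + \<bar>v r\<bar> \<le> Q; t \<in> {0..h};
          \<And>r. r \<in> {0..h} \<Longrightarrow>
            (X has_real_derivative lambda_Sigma \<alpha> \<beta> \<gamma> \<zeta> * X r + s) (at r within {0..h});
          X 0 = x 0\<rbrakk>
        \<Longrightarrow> \<bar>x t - X t\<bar> \<le> k * (\<epsilon> * Q)"
proof -
  define \<kappa> where "\<kappa> = lambda_Sigma \<alpha> \<beta> \<gamma> \<zeta>"
  define d where "d = 2 * \<beta> / \<zeta>"
  define L where "L = exp (\<bar>\<kappa>\<bar> * T) * (1 + 1 / \<bar>\<kappa>\<bar>)"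
  define k2 where "k2 = L * (\<bar>d\<bar> + \<bar>d\<bar> * (\<bar>\<kappa>\<bar> + \<bar>\<alpha>\<bar> + \<bar>\<beta>\<bar>)) + \<bar>d\<bar>"
  define k3 where "k3 = 1 + 2 * \<bar>2 * \<gamma> / \<zeta>\<bar>"
  define k1 where "k1 = L + k2"
  define k4 where "k4 = k3 / \<bar>\<zeta>\<bar> * (\<bar>\<gamma>\<bar> * k1 + (\<bar>\<alpha>\<bar> + \<bar>\<beta>\<bar>) + 1)"
  define k where "k = k1 + k3 + k4"
  have L0: "0 \<le> L" by (simp add: L_def)
  have k20: "0 \<le> k2" using L0 by (simp add: k2_def)
  have k30: "1 \<le> k3" by (simp add: k3_def)
  have k10: "0 \<le> k1" using L0 k20 by (simp add: k1_def)
  have k40: "0 \<le> k4" using k10 k30 by (simp add: k4_def)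
  note slow = slow_component_bound[OF \<zeta> \<kappa>, of _ _ _ T, folded \<kappa>_def d_def, folded L_def, folded k2_def]
  have A: "\<bar>x t\<bar> \<le> k1 * (\<bar>x 0\<bar> + \<bar>s\<bar> + \<epsilon> * Q)"
    and B: "\<bar>u t\<bar> + \<bar>v t\<bar> \<le> k3 * (exp (\<zeta> / \<epsilon> * t) * (\<bar>u 0\<bar> + \<bar>v 0\<bar>)) + k4 * (\<bar>x 0\<bar> + \<bar>s\<bar> + \<epsilon> * Q)"
    and Qn: "0 \<le> Q"
    if \<epsilon>: "\<epsilon> > 0" and hT: "h \<le> T" and flow: "covariance_flow \<alpha> \<beta> \<gamma> \<zeta> \<epsilon> s h x u v"
      and Q: "\<And>r. r \<in> {0..h} \<Longrightarrow> \<bar>u r\<bar> + \<bar>v r\<bar> \<le> Q" and t: "t \<in> {0..h}" for \<epsilon> h s x u v Q t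
  proof -
    show Qn: "0 \<le> Q" using Q[OF t] by linarith
    have A: "\<bar>x r\<bar> \<le> k1 * (\<bar>x 0\<bar> + \<bar>s\<bar> + \<epsilon> * Q)" if r: "r \<in> {0..h}" for r
    proof -
      \<comment> \<open>The zero function solves the reduced equation with source 0, which turns the
        comparison into an a priori bound on \<open>x\<close>.\<close>
      have "\<bar>x r - 0\<bar> \<le> L * (\<bar>x 0 - 0\<bar> + \<bar>s - 0\<bar>) + k2 * (\<epsilon> * Q)"
        by (rule slow[where X = "\<lambda>_. 0", OF \<epsilon> r hT flow Q]) auto
      moreover have "0 \<le> k2 * (\<bar>x 0\<bar> + \<bar>s\<bar>)" "0 \<le> L * (\<epsilon> * Q)" using k20 L0 Qn \<epsilon> by auto
      ultimately show ?thesis unfolding k1_def by (simp add: algebra_simps)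
    qed
    then show "\<bar>x t\<bar> \<le> k1 * (\<bar>x 0\<bar> + \<bar>s\<bar> + \<epsilon> * Q)" using t .
    have eQ: "0 \<le> \<epsilon> * Q" using \<epsilon> Qn by simp
    have "\<bar>u t\<bar> + \<bar>v t\<bar> \<le> k3 * (exp (\<zeta> / \<epsilon> * t) * (\<bar>u 0\<bar> + \<bar>v 0\<bar>))
      + k3 / \<bar>\<zeta>\<bar> * (\<bar>\<gamma>\<bar> * (k1 * (\<bar>x 0\<bar> + \<bar>s\<bar> + \<epsilon> * Q)) + (\<bar>\<alpha>\<bar> + \<bar>\<beta>\<bar>) * (\<epsilon> * Q) + \<bar>s\<bar>)"
      unfolding k3_def by (rule fast_components_bound[OF \<zeta> \<epsilon> t flow Q A])
    also have "\<dots> \<le> k3 * (exp (\<zeta> / \<epsilon> * t) * (\<bar>u 0\<bar> + \<bar>v 0\<bar>))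
      + k3 / \<bar>\<zeta>\<bar> * (\<bar>\<gamma>\<bar> * (k1 * (\<bar>x 0\<bar> + \<bar>s\<bar> + \<epsilon> * Q))
        + (\<bar>\<alpha>\<bar> + \<bar>\<beta>\<bar>) * (\<bar>x 0\<bar> + \<bar>s\<bar> + \<epsilon> * Q) + (\<bar>x 0\<bar> + \<bar>s\<bar> + \<epsilon> * Q))"
      using eQ k30 by (intro add_left_mono mult_left_mono add_mono) auto
    finally show "\<bar>u t\<bar> + \<bar>v t\<bar> \<le> k3 * (exp (\<zeta> / \<epsilon> * t) * (\<bar>u 0\<bar> + \<bar>v 0\<bar>)) + k4 * (\<bar>x 0\<bar> + \<bar>s\<bar> + \<epsilon> * Q)"
      unfolding k4_def by (simp add: algebra_simps add_divide_distrib)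
  qed
  show thesis
  proof (rule that[of k])
    show "k \<ge> 1" using k10 k30 k40 by (simp add: k_def)
  next
    fix \<epsilon> h s x u v Q t
    assume *: "\<epsilon> > 0" "h \<le> T" "covariance_flow \<alpha> \<beta> \<gamma> \<zeta> \<epsilon> s h x u v"
      "\<And>r. r \<in> {0..h} \<Longrightarrow> \<bar>u r\<bar> + \<bar>v r\<bar> \<le> Q" "t \<in> {0..h}"
    have Qn: "0 \<le> Q" by (rule Qn[OF *])
    let ?M = "\<bar>x 0\<bar> + \<bar>s\<bar> + \<epsilon> * Q" and ?e = "exp (\<zeta> / \<epsilon> * t) * (\<bar>u 0\<bar> + \<bar>v 0\<bar>)"
    have M: "0 \<le> ?M" using Qn *(1) by simp
    have "k1 * ?M \<le> k * ?M" by (rule mult_right_mono[OF _ M]) (use k30 k40 in \<open>simp add: k_def\<close>)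
    moreover have "k3 * ?e \<le> k * ?e" using k10 k40 by (intro mult_right_mono) (auto simp: k_def)
    moreover have "k4 * ?M \<le> k * ?M" by (rule mult_right_mono[OF _ M]) (use k30 k10 in \<open>simp add: k_def\<close>)
    ultimately show "\<bar>x t\<bar> \<le> k * (\<bar>x 0\<bar> + \<bar>s\<bar> + \<epsilon> * Q) \<and>
        \<bar>u t\<bar> + \<bar>v t\<bar> \<le> k * (exp (\<zeta> / \<epsilon> * t) * (\<bar>u 0\<bar> + \<bar>v 0\<bar>) + \<bar>x 0\<bar> + \<bar>s\<bar> + \<epsilon> * Q)"
      using A[OF *] B[OF *] by (simp add: distrib_left)
  next
    fix \<epsilon> h s x u v Q t and X :: "real \<Rightarrow> real"
    assume *: "\<epsilon> > 0" "h \<le> T" "covariance_flow \<alpha> \<beta> \<gamma> \<zeta> \<epsilon> s h x u v"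
      "\<And>r. r \<in> {0..h} \<Longrightarrow> \<bar>u r\<bar> + \<bar>v r\<bar> \<le> Q" "t \<in> {0..h}"
      and X: "\<And>r. r \<in> {0..h} \<Longrightarrow>
            (X has_real_derivative lambda_Sigma \<alpha> \<beta> \<gamma> \<zeta> * X r + s) (at r within {0..h})"
      and X0: "X 0 = x 0"
    have Qn: "0 \<le> Q" by (rule Qn[OF *])
    have "\<bar>x t - X t\<bar> \<le> L * (\<bar>x 0 - X 0\<bar> + \<bar>s - s\<bar>) + k2 * (\<epsilon> * Q)"
      by (rule slow[OF *(1) *(5) *(2) *(3) *(4) X[folded \<kappa>_def]])
    also have "\<dots> \<le> k * (\<epsilon> * Q)"
      using X0 L0 k30 k40 Qn *(1) by (auto intro!: mult_right_mono simp: k_def k1_def)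
    finally show "\<bar>x t - X t\<bar> \<le> k * (\<epsilon> * Q)" .
  qed
qed

text \<open>Taking the maximum of \<open>\<bar>u\<bar> + \<bar>v\<bar>\<close> as \<open>Q\<close>
  makes the implicit bound an inequality for \<open>Q\<close>, and smallness of \<epsilon> absorbs
  \<open>k * \<epsilon> * Q\<close>. The threshold depends on \<open>k\<close> alone, hence not on
  \<open>h\<close>; \<open>K\<close> depends on \<open>h\<close> through the decay over one
  step.\<close>

lemma flow_bounds:
  fixes \<alpha> \<beta> \<gamma> \<zeta> T :: real
  assumes \<zeta>: "\<zeta> < 0" and \<kappa>: "lambda_Sigma \<alpha> \<beta> \<gamma> \<zeta> \<noteq> 0"
  obtains \<epsilon>0 where "0 < \<epsilon>0" "\<epsilon>0 < 1"
    and "\<And>h. 0 < h \<Longrightarrow> h \<le> T \<Longrightarrow> \<exists>K\<ge>0. \<forall>\<epsilon> s x u v. 0 < \<epsilon> \<longrightarrow> \<epsilon> < \<epsilon>0 \<longrightarrow>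
      covariance_flow \<alpha> \<beta> \<gamma> \<zeta> \<epsilon> s h x u v \<longrightarrow>
      (\<forall>t\<in>{0..h}. \<bar>x t\<bar> + (\<bar>u t\<bar> + \<bar>v t\<bar>) \<le> K * (\<bar>x 0\<bar> + (\<bar>u 0\<bar> + \<bar>v 0\<bar>) + \<bar>s\<bar>)) \<and>
      \<bar>u h\<bar> + \<bar>v h\<bar> \<le> K * (\<bar>x 0\<bar> + \<bar>s\<bar>) + K * \<epsilon> * (\<bar>x 0\<bar> + (\<bar>u 0\<bar> + \<bar>v 0\<bar>) + \<bar>s\<bar>) \<and>
      (\<forall>X. X 0 = x 0 \<and> (\<forall>t\<in>{0..h}. (X has_real_derivative lambda_Sigma \<alpha> \<beta> \<gamma> \<zeta> * X t + s)
            (at t within {0..h})) \<longrightarrow>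
        \<bar>x h - X h\<bar> \<le> K * \<epsilon> * (\<bar>x 0\<bar> + (\<bar>u 0\<bar> + \<bar>v 0\<bar>) + \<bar>s\<bar>))"
proof -
  obtain k where k1: "k \<ge> 1"
    and k: "\<And>\<epsilon> h s x u v Q t. \<lbrakk>\<epsilon> > 0; h \<le> T; covariance_flow \<alpha> \<beta> \<gamma> \<zeta> \<epsilon> s h x u v;
          \<And>r. r \<in> {0..h} \<Longrightarrow> \<bar>u r\<bar> + \<bar>v r\<bar> \<le> Q; t \<in> {0..h}\<rbrakk>
        \<Longrightarrow> \<bar>x t\<bar> \<le> k * (\<bar>x 0\<bar> + \<bar>s\<bar> + \<epsilon> * Q) \<and>
          \<bar>u t\<bar> + \<bar>v t\<bar> \<le> k * (exp (\<zeta> / \<epsilon> * t) * (\<bar>u 0\<bar> + \<bar>v 0\<bar>) + \<bar>x 0\<bar> + \<bar>s\<bar> + \<epsilon> * Q)"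
    and kX: "\<And>\<epsilon> h s x u v Q X t. \<lbrakk>\<epsilon> > 0; h \<le> T; covariance_flow \<alpha> \<beta> \<gamma> \<zeta> \<epsilon> s h x u v;
          \<And>r. r \<in> {0..h} \<Longrightarrow> \<bar>u r\<bar> + \<bar>v r\<bar> \<le> Q; t \<in> {0..h};
          \<And>r. r \<in> {0..h} \<Longrightarrow>
            (X has_real_derivative lambda_Sigma \<alpha> \<beta> \<gamma> \<zeta> * X r + s) (at r within {0..h});
          X 0 = x 0\<rbrakk>
        \<Longrightarrow> \<bar>x t - X t\<bar> \<le> k * (\<epsilon> * Q)"
    by (rule flow_implicit_bounds[OF \<zeta> \<kappa>, of T]) blast
  define \<epsilon>0 where "\<epsilon>0 = 1 / (2 * k)"
  have \<epsilon>0: "0 < \<epsilon>0" "\<epsilon>0 < 1" using k1 by (auto simp: \<epsilon>0_def)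
  have main: "(\<forall>t\<in>{0..h}. \<bar>x t\<bar> + (\<bar>u t\<bar> + \<bar>v t\<bar>) \<le> (k * (1 + 2 * k) + 2 * k) * M)
      \<and> \<bar>u h\<bar> + \<bar>v h\<bar> \<le> k * (\<bar>x 0\<bar> + \<bar>s\<bar>) + (k / (\<bar>\<zeta>\<bar> * h) + 2 * k * k) * \<epsilon> * M
      \<and> (\<forall>X. X 0 = x 0 \<and> (\<forall>t\<in>{0..h}. (X has_real_derivative lambda_Sigma \<alpha> \<beta> \<gamma> \<zeta> * X t + s)
            (at t within {0..h})) \<longrightarrow> \<bar>x h - X h\<bar> \<le> (2 * k * k) * \<epsilon> * M)"
    if h: "0 < h" "h \<le> T" and \<epsilon>: "0 < \<epsilon>" "\<epsilon> < \<epsilon>0"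
      and flow: "covariance_flow \<alpha> \<beta> \<gamma> \<zeta> \<epsilon> s h x u v"
      and M: "M = \<bar>x 0\<bar> + (\<bar>u 0\<bar> + \<bar>v 0\<bar>) + \<bar>s\<bar>" for h \<epsilon> s x u v M
  proof -
    have M0: "0 \<le> M" by (simp add: M)
    have "continuous_on {0..h} u" "continuous_on {0..h} v"
      using flow unfolding covariance_flow_def
      by (meson DERIV_continuous continuous_on_eq_continuous_within)+
    then have "continuous_on {0..h} (\<lambda>t. \<bar>u t\<bar> + \<bar>v t\<bar>)" by (intro continuous_intros)
    then obtain t' where t': "t' \<in> {0..h}"
      and Q: "\<And>r. r \<in> {0..h} \<Longrightarrow> \<bar>u r\<bar> + \<bar>v r\<bar> \<le> \<bar>u t'\<bar> + \<bar>v t'\<bar>"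
      using continuous_attains_sup[of "{0..h}" "\<lambda>t. \<bar>u t\<bar> + \<bar>v t\<bar>"] h by auto
    define Q where "Q = \<bar>u t'\<bar> + \<bar>v t'\<bar>"
    note Q = Q[folded Q_def]
    have Q0: "0 \<le> Q" by (simp add: Q_def)
    have kk: "\<bar>x t\<bar> \<le> k * (\<bar>x 0\<bar> + \<bar>s\<bar> + \<epsilon> * Q) \<and>
        \<bar>u t\<bar> + \<bar>v t\<bar> \<le> k * (exp (\<zeta> / \<epsilon> * t) * (\<bar>u 0\<bar> + \<bar>v 0\<bar>) + \<bar>x 0\<bar> + \<bar>s\<bar> + \<epsilon> * Q)"
      if "t \<in> {0..h}" for t
      by (rule k[OF \<epsilon>(1) h(2) flow _ that]) (rule Q)
    \<comment> \<open>At the maximizing time \<open>t'\<close> the decay factor is at most 1, so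
      \<open>Q \<le> k * (M + \<epsilon> * Q)\<close>; since
      \<open>\<epsilon>0 = 1 / (2 * k)\<close>, the last term is at most
      \<open>Q / 2\<close>.\<close>
    have QM: "Q \<le> 2 * k * M"
    proof -
      have "exp (\<zeta> / \<epsilon> * t') * (\<bar>u 0\<bar> + \<bar>v 0\<bar>) \<le> 1 * (\<bar>u 0\<bar> + \<bar>v 0\<bar>)"
        using \<zeta> \<epsilon> t' by (intro mult_right_mono) (auto simp: divide_nonpos_pos mult_nonpos_nonneg)
      then have "k * (exp (\<zeta> / \<epsilon> * t') * (\<bar>u 0\<bar> + \<bar>v 0\<bar>) + \<bar>x 0\<bar> + \<bar>s\<bar> + \<epsilon> * Q) \<le> k * (M + \<epsilon> * Q)"
        using k1 by (intro mult_left_mono) (auto simp: M)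
      then have "Q \<le> k * (M + \<epsilon> * Q)" using kk[OF t'] unfolding Q_def by linarith
      moreover have "k * \<epsilon> * Q \<le> (1 / 2) * Q"
        using \<epsilon>(2) k1 by (intro mult_right_mono[OF _ Q0]) (simp add: \<epsilon>0_def field_simps)
      ultimately show ?thesis by (simp add: algebra_simps)
    qed
    \<comment> \<open>The first version keeps \<epsilon> for the O(\<epsilon>) estimates; the second
      drops it by \<open>\<epsilon> < 1\<close> for the plain bound on \<open>x\<close>.\<close>
    have \<epsilon>Q: "\<epsilon> * Q \<le> 2 * k * \<epsilon> * M"
      using mult_left_mono[OF QM, of \<epsilon>] \<epsilon> by (simp add: algebra_simps)
    have \<epsilon>Q': "\<epsilon> * Q \<le> 2 * k * M"
      using mult_right_mono[OF less_imp_le[OF less_trans[OF \<epsilon>(2) \<epsilon>0(2)]] Q0] QM by simp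
    show ?thesis
    proof (intro conjI ballI allI impI)
      fix t assume t: "t \<in> {0..h}"
      have "\<bar>x t\<bar> \<le> k * (\<bar>x 0\<bar> + \<bar>s\<bar> + \<epsilon> * Q)" using kk[OF t] by simp
      also have "\<dots> \<le> k * (M + 2 * k * M)"
        using \<epsilon>Q' k1 by (intro mult_left_mono add_mono) (auto simp: M)
      finally show "\<bar>x t\<bar> + (\<bar>u t\<bar> + \<bar>v t\<bar>) \<le> (k * (1 + 2 * k) + 2 * k) * M"
        using Q[OF t] QM by (simp add: algebra_simps)
    next
      \<comment> \<open>Exponential decay is traded for one power of \<epsilon>:
        \<open>w \<le> exp w\<close> at \<open>w = \<bar>\<zeta>\<bar> * h / \<epsilon>\<close>,
        inverted.\<close>
      have e: "exp (\<zeta> / \<epsilon> * h) \<le> \<epsilon> / (\<bar>\<zeta>\<bar> * h)"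
      proof -
        have y: "0 < \<bar>\<zeta>\<bar> * h / \<epsilon>" using \<zeta> h \<epsilon> by (intro divide_pos_pos mult_pos_pos) auto
        have "\<bar>\<zeta>\<bar> * h / \<epsilon> \<le> exp (\<bar>\<zeta>\<bar> * h / \<epsilon>)" using exp_ge_add_one_self[of "\<bar>\<zeta>\<bar> * h / \<epsilon>"] by linarith
        then have "inverse (exp (\<bar>\<zeta>\<bar> * h / \<epsilon>)) \<le> inverse (\<bar>\<zeta>\<bar> * h / \<epsilon>)" using y by (rule le_imp_inverse_le)
        then show ?thesis using \<zeta> by (simp flip: exp_minus)
      qed
      have "exp (\<zeta> / \<epsilon> * h) * (\<bar>u 0\<bar> + \<bar>v 0\<bar>) \<le> \<epsilon> / (\<bar>\<zeta>\<bar> * h) * M"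
        using e h \<epsilon> by (intro mult_mono) (auto simp: M)
      then have "k * (exp (\<zeta> / \<epsilon> * h) * (\<bar>u 0\<bar> + \<bar>v 0\<bar>) + \<bar>x 0\<bar> + \<bar>s\<bar> + \<epsilon> * Q)
         \<le> k * (\<epsilon> / (\<bar>\<zeta>\<bar> * h) * M + \<bar>x 0\<bar> + \<bar>s\<bar> + 2 * k * \<epsilon> * M)"
        using \<epsilon>Q k1 by (intro mult_left_mono) auto
      moreover have "\<bar>u h\<bar> + \<bar>v h\<bar> \<le> k * (exp (\<zeta> / \<epsilon> * h) * (\<bar>u 0\<bar> + \<bar>v 0\<bar>) + \<bar>x 0\<bar> + \<bar>s\<bar> + \<epsilon> * Q)"
        using kk[of h] h by simp
      ultimately show "\<bar>u h\<bar> + \<bar>v h\<bar> \<le> k * (\<bar>x 0\<bar> + \<bar>s\<bar>) + (k / (\<bar>\<zeta>\<bar> * h) + 2 * k * k) * \<epsilon> * M"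
        by (simp add: algebra_simps)
    next
      fix X assume X: "X 0 = x 0 \<and> (\<forall>t\<in>{0..h}.
        (X has_real_derivative lambda_Sigma \<alpha> \<beta> \<gamma> \<zeta> * X t + s) (at t within {0..h}))"
      have "\<bar>x h - X h\<bar> \<le> k * (\<epsilon> * Q)"
        by (rule kX[OF \<epsilon>(1) h(2) flow Q]) (use X h in auto)
      also have "\<dots> \<le> k * (2 * k * \<epsilon> * M)" using \<epsilon>Q k1 by (intro mult_left_mono) auto
      finally show "\<bar>x h - X h\<bar> \<le> (2 * k * k) * \<epsilon> * M" by (simp add: algebra_simps)
    qed
  qed
  show thesis
  proof (rule that[OF \<epsilon>0])
    fix h :: real assume h: "0 < h" "h \<le> T"
    define K1 K2 K3 where "K1 = k * (1 + 2 * k) + 2 * k" and "K2 = k / (\<bar>\<zeta>\<bar> * h) + 2 * k * k"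
      and "K3 = 2 * k * k"
    define K where "K = k + K1 + K2 + K3"
    have "0 \<le> K1" "0 \<le> K2" "0 \<le> K3" using k1 h by (auto simp: K1_def K2_def K3_def)
    then have K: "0 \<le> K" "k \<le> K" "K1 \<le> K" "K2 \<le> K" "K3 \<le> K" using k1 by (auto simp: K_def)
    have mono: "C * M \<le> K * M" if "C \<le> K" "0 \<le> M" for C M using that by (rule mult_right_mono)
    show "\<exists>K\<ge>0. \<forall>\<epsilon> s x u v. 0 < \<epsilon> \<longrightarrow> \<epsilon> < \<epsilon>0 \<longrightarrow>
      covariance_flow \<alpha> \<beta> \<gamma> \<zeta> \<epsilon> s h x u v \<longrightarrow>
      (\<forall>t\<in>{0..h}. \<bar>x t\<bar> + (\<bar>u t\<bar> + \<bar>v t\<bar>) \<le> K * (\<bar>x 0\<bar> + (\<bar>u 0\<bar> + \<bar>v 0\<bar>) + \<bar>s\<bar>)) \<and>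
      \<bar>u h\<bar> + \<bar>v h\<bar> \<le> K * (\<bar>x 0\<bar> + \<bar>s\<bar>) + K * \<epsilon> * (\<bar>x 0\<bar> + (\<bar>u 0\<bar> + \<bar>v 0\<bar>) + \<bar>s\<bar>) \<and>
      (\<forall>X. X 0 = x 0 \<and> (\<forall>t\<in>{0..h}. (X has_real_derivative lambda_Sigma \<alpha> \<beta> \<gamma> \<zeta> * X t + s)
            (at t within {0..h})) \<longrightarrow>
        \<bar>x h - X h\<bar> \<le> K * \<epsilon> * (\<bar>x 0\<bar> + (\<bar>u 0\<bar> + \<bar>v 0\<bar>) + \<bar>s\<bar>))"
    proof (intro exI[of _ K] conjI allI impI, rule K(1))
      fix \<epsilon> s x u v assume \<epsilon>: "0 < \<epsilon>" "\<epsilon> < \<epsilon>0" and flow: "covariance_flow \<alpha> \<beta> \<gamma> \<zeta> \<epsilon> s h x u v"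
      define M where "M = \<bar>x 0\<bar> + (\<bar>u 0\<bar> + \<bar>v 0\<bar>) + \<bar>s\<bar>"
      have M0: "0 \<le> M" "0 \<le> \<epsilon> * M" using \<epsilon> by (auto simp: M_def)
      note m = main[OF h \<epsilon> flow M_def, folded K1_def K2_def K3_def]
      show "\<forall>t\<in>{0..h}. \<bar>x t\<bar> + (\<bar>u t\<bar> + \<bar>v t\<bar>) \<le> K * (\<bar>x 0\<bar> + (\<bar>u 0\<bar> + \<bar>v 0\<bar>) + \<bar>s\<bar>)"
        unfolding M_def[symmetric] using m mono[OF K(3) M0(1)] by fastforce
      have "\<bar>u h\<bar> + \<bar>v h\<bar> \<le> k * (\<bar>x 0\<bar> + \<bar>s\<bar>) + K2 * (\<epsilon> * M)" using m by (simp add: mult.assoc)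
      also have "\<dots> \<le> K * (\<bar>x 0\<bar> + \<bar>s\<bar>) + K * (\<epsilon> * M)"
        by (intro add_mono mono K M0) auto
      finally show "\<bar>u h\<bar> + \<bar>v h\<bar> \<le> K * (\<bar>x 0\<bar> + \<bar>s\<bar>) + K * \<epsilon> * (\<bar>x 0\<bar> + (\<bar>u 0\<bar> + \<bar>v 0\<bar>) + \<bar>s\<bar>)"
        unfolding M_def[symmetric] by (simp add: mult.assoc)
      fix X assume "X 0 = x 0 \<and> (\<forall>t\<in>{0..h}.
        (X has_real_derivative lambda_Sigma \<alpha> \<beta> \<gamma> \<zeta> * X t + s) (at t within {0..h}))"
      then have "\<bar>x h - X h\<bar> \<le> K3 * (\<epsilon> * M)" using m by (simp add: mult.assoc)
      also have "\<dots> \<le> K * (\<epsilon> * M)" by (intro mono K M0)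
      finally show "\<bar>x h - X h\<bar> \<le> K * \<epsilon> * (\<bar>x 0\<bar> + (\<bar>u 0\<bar> + \<bar>v 0\<bar>) + \<bar>s\<bar>)"
        unfolding M_def[symmetric] by (simp add: mult.assoc)
    qed
  qed
qed

section \<open>The discrete error recursion\<close>

text \<open>Each step adds \<open>d\<close> and amplifies the earlier contributions by
  \<open>c\<close>. Replacing the geometric sum by \<open>N\<close> copies of \<open>c ^ N\<close>
  is crude but free of \<epsilon>.\<close>

lemma discrete_gronwall:
  fixes a :: "nat \<Rightarrow> real"
  assumes "a 0 = 0" and step: "\<And>n. n < N \<Longrightarrow> a (Suc n) \<le> c * a n + d"
    and c: "c \<ge> 1" and d: "d \<ge> 0" and n: "n \<le> N"
  shows "a n \<le> real N * c ^ N * d"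
proof -
  have "a n \<le> real n * c ^ n * d" using n
  proof (induction n)
    case (Suc n)
    have "a (Suc n) \<le> c * a n + d" using Suc.prems by (intro step) simp
    also have "\<dots> \<le> c * (real n * c ^ n * d) + c ^ Suc n * d"
      using Suc c d one_le_power[OF c, of "Suc n"] by (intro add_mono mult_left_mono)
        (auto simp del: power_Suc intro: mult_right_mono[of 1 _ d, simplified])
    finally show ?case by (simp add: algebra_simps)
  qed (use assms in auto)
  also have "\<dots> \<le> real N * c ^ N * d"
    using n c d by (intro mult_mono power_increasing) auto
  finally show ?thesis .
qed

text \<open>The exponents solve the recursion for the orders: \<open>a = (k + 2) div 2\<close> and
  \<open>b = (k + 1) div 2\<close> satisfy \<open>b \<le> a\<close> and
  \<open>a \<le> b + 1\<close>, so the next orders are \<open>b + 1\<close> and \<open>a\<close>.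
  \<open>C\<close> precedes \<epsilon>, \<open>E\<close> and \<open>f\<close>, which makes it
  uniform in them.\<close>

lemma parareal_error_recursion:
  fixes c K D :: real
  assumes c: "c \<ge> 1" and K: "K \<ge> 0" and D: "D \<ge> 0"
  shows "\<exists>C\<ge>0. \<forall>\<epsilon> E f. 0 < \<epsilon> \<longrightarrow> \<epsilon> < 1 \<longrightarrow> (\<forall>k. E k 0 = (0::real) \<and> f k 0 = (0::real)) \<longrightarrow>
    (\<forall>n\<le>N. \<bar>E 0 n\<bar> \<le> D * \<epsilon> \<and> f 0 n \<le> D) \<longrightarrow>
    (\<forall>k n. n < N \<longrightarrow> \<bar>E (Suc k) (Suc n)\<bar> \<le> c * \<bar>E (Suc k) n\<bar> + K * \<epsilon> * (\<bar>E k n\<bar> + f k n) \<and>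
       f (Suc k) (Suc n) \<le> K * \<bar>E k n\<bar> + K * \<epsilon> * (\<bar>E k n\<bar> + f k n)) \<longrightarrow>
    (\<forall>n\<le>N. \<bar>E k n\<bar> \<le> C * \<epsilon> ^ ((k + 2) div 2) \<and> f k n \<le> C * \<epsilon> ^ ((k + 1) div 2))"
proof (induction k)
  case 0
  show ?case by (rule exI[of _ D]) (use D in auto)
next
  case (Suc k)
  then obtain C where C: "C \<ge> 0" and IH: "\<And>\<epsilon> E f n. \<lbrakk>0 < \<epsilon>; \<epsilon> < 1; \<forall>k. E k 0 = (0::real) \<and> f k 0 = (0::real);
     \<forall>n\<le>N. \<bar>E 0 n\<bar> \<le> D * \<epsilon> \<and> f 0 n \<le> D;
     \<forall>k n. n < N \<longrightarrow> \<bar>E (Suc k) (Suc n)\<bar> \<le> c * \<bar>E (Suc k) n\<bar> + K * \<epsilon> * (\<bar>E k n\<bar> + f k n) \<and>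
       f (Suc k) (Suc n) \<le> K * \<bar>E k n\<bar> + K * \<epsilon> * (\<bar>E k n\<bar> + f k n); n \<le> N\<rbrakk> \<Longrightarrow>
     \<bar>E k n\<bar> \<le> C * \<epsilon> ^ ((k + 2) div 2) \<and> f k n \<le> C * \<epsilon> ^ ((k + 1) div 2)"
    by metis
  \<comment> \<open>\<open>2 * K * C\<close> comes from
    \<open>\<bar>E k n\<bar> + f k n \<le> 2 * C * \<epsilon> ^ b\<close>; the third
    \<open>K * C\<close> in \<open>C2\<close> comes from the term
    \<open>K * \<bar>E k n\<bar>\<close>, which has no factor \<epsilon>.\<close>
  define C1 C2 where "C1 = real N * c ^ N * (2 * K * C)" and "C2 = 3 * K * C"
  have C12: "0 \<le> C1" "0 \<le> C2" using c K C by (auto simp: C1_def C2_def)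
  show ?case
  proof (intro exI[of _ "C1 + C2"] conjI allI impI)
    show "0 \<le> C1 + C2" using C12 by simp
    fix \<epsilon> :: real and E f :: "nat \<Rightarrow> nat \<Rightarrow> real" and n
    assume \<epsilon>: "0 < \<epsilon>" "\<epsilon> < 1" and z: "\<forall>k. E k 0 = 0 \<and> f k 0 = 0"
      and i: "\<forall>n\<le>N. \<bar>E 0 n\<bar> \<le> D * \<epsilon> \<and> f 0 n \<le> D"
      and s: "\<forall>k n. n < N \<longrightarrow> \<bar>E (Suc k) (Suc n)\<bar> \<le> c * \<bar>E (Suc k) n\<bar> + K * \<epsilon> * (\<bar>E k n\<bar> + f k n) \<and>
       f (Suc k) (Suc n) \<le> K * \<bar>E k n\<bar> + K * \<epsilon> * (\<bar>E k n\<bar> + f k n)"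
      and n: "n \<le> N"
    define b where "b = (k + 1) div 2"
    define a where "a = (k + 2) div 2"
    have ab: "b \<le> a" "a \<le> Suc b" by (auto simp: a_def b_def)
    note IH = IH[OF \<epsilon> z i s, folded a_def b_def]
    have sum: "K * \<epsilon> * (\<bar>E k m\<bar> + f k m) \<le> 2 * K * C * \<epsilon> ^ Suc b" if "m \<le> N" for m
    proof -
      have "C * \<epsilon> ^ a \<le> C * \<epsilon> ^ b" using C \<epsilon> ab by (intro mult_left_mono power_decreasing) auto
      then have "\<bar>E k m\<bar> + f k m \<le> 2 * C * \<epsilon> ^ b" using IH[OF that] by linarith
      then have "K * \<epsilon> * (\<bar>E k m\<bar> + f k m) \<le> K * \<epsilon> * (2 * C * \<epsilon> ^ b)"
        using K \<epsilon> by (intro mult_left_mono) auto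
      then show ?thesis by (simp add: algebra_simps)
    qed
    \<comment> \<open>The new macro error also feeds on itself from one time step to the next, so it
      is summed over time; the new micro error depends on the old iterate only.\<close>
    have "\<bar>E (Suc k) n\<bar> \<le> real N * c ^ N * (2 * K * C * \<epsilon> ^ Suc b)"
    proof (rule discrete_gronwall[OF _ _ c _ n])
      show "\<bar>E (Suc k) (Suc m)\<bar> \<le> c * \<bar>E (Suc k) m\<bar> + 2 * K * C * \<epsilon> ^ Suc b" if "m < N" for m
        using s[rule_format, OF that, of k] sum[of m] that by linarith
    qed (use z K C \<epsilon> in auto)
    also have "\<dots> = C1 * \<epsilon> ^ Suc b" by (simp add: C1_def algebra_simps)
    also have "\<dots> \<le> (C1 + C2) * \<epsilon> ^ Suc b" using C12 \<epsilon> by (intro mult_right_mono) auto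
    finally show "\<bar>E (Suc k) n\<bar> \<le> (C1 + C2) * \<epsilon> ^ ((Suc k + 2) div 2)" by (simp add: b_def)
    have "f (Suc k) n \<le> C2 * \<epsilon> ^ a"
    proof (cases n)
      case 0
      then show ?thesis using z C12 \<epsilon> by simp
    next
      case (Suc m)
      then have m: "m < N" using n by simp
      have "f (Suc k) (Suc m) \<le> K * (C * \<epsilon> ^ a) + 2 * K * C * \<epsilon> ^ Suc b"
        using s[rule_format, OF m, of k] sum[of m] mult_left_mono[OF IH[of m, THEN conjunct1] K] m
        by linarith
      also have "\<dots> \<le> K * (C * \<epsilon> ^ a) + 2 * K * C * \<epsilon> ^ a"
        using K C \<epsilon> ab by (intro add_left_mono mult_left_mono power_decreasing) auto
      finally show ?thesis by (simp add: Suc C2_def algebra_simps)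
    qed
    also have "\<dots> \<le> (C1 + C2) * \<epsilon> ^ a" using C12 \<epsilon> by (intro mult_right_mono) auto
    finally show "f (Suc k) n \<le> (C1 + C2) * \<epsilon> ^ ((Suc k + 1) div 2)" by (simp add: a_def)
  qed
qed

section \<open>From the differential equations to the propagators\<close>

lemma covariance_flow_diff:
  assumes "covariance_flow \<alpha> \<beta> \<gamma> \<zeta> \<epsilon> s h x u v" "covariance_flow \<alpha> \<beta> \<gamma> \<zeta> \<epsilon> s' h x' u' v'"
  shows "covariance_flow \<alpha> \<beta> \<gamma> \<zeta> \<epsilon> (s - s') h (\<lambda>t. x t - x' t) (\<lambda>t. u t - u' t) (\<lambda>t. v t - v' t)"
  unfolding covariance_flow_def
proof (intro ballI conjI)
  fix t assume "t \<in> {0..h}"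
  note D = assms[unfolded covariance_flow_def, rule_format, OF this]
  show "((\<lambda>t. x t - x' t) has_real_derivative
      2 * \<alpha> * (x t - x' t) + 2 * \<beta> * (u t - u' t) + (s - s')) (at t within {0..h})"
    by (rule DERIV_cong[OF DERIV_diff[OF D(1)[THEN conjunct1] D(2)[THEN conjunct1]]])
      (simp add: algebra_simps)
  show "((\<lambda>t. u t - u' t) has_real_derivative
      \<gamma> / \<epsilon> * (x t - x' t) + (\<alpha> + \<zeta> / \<epsilon>) * (u t - u' t) + \<beta> * (v t - v' t)) (at t within {0..h})"
    by (rule DERIV_cong[OF DERIV_diff[OF D(1)[THEN conjunct2, THEN conjunct1]
        D(2)[THEN conjunct2, THEN conjunct1]]]) (simp add: algebra_simps)
  show "((\<lambda>t. v t - v' t) has_real_derivative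
      2 * \<gamma> / \<epsilon> * (u t - u' t) + 2 * \<zeta> / \<epsilon> * (v t - v' t) + (s - s') / \<epsilon>) (at t within {0..h})"
    by (rule DERIV_cong[OF DERIV_diff[OF D(1)[THEN conjunct2, THEN conjunct2]
        D(2)[THEN conjunct2, THEN conjunct2]]]) (simp add: algebra_simps diff_divide_distrib)
qed

lemma solves_fine_imp_covariance_flow:
  assumes "solves_ivp (fine_rhs \<alpha> \<beta> \<gamma> \<zeta> \<sigma> \<epsilon>) S h y"
  shows "covariance_flow \<alpha> \<beta> \<gamma> \<zeta> \<epsilon> (\<sigma>\<^sup>2) h (\<lambda>t. y t $ 1) (\<lambda>t. y t $ 2) (\<lambda>t. y t $ 3)"
  unfolding covariance_flow_def
proof
  fix t assume "t \<in> {0..h}"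
  then have "(y has_vector_derivative fine_rhs \<alpha> \<beta> \<gamma> \<zeta> \<sigma> \<epsilon> (y t)) (at t within {0..h})"
    using assms by (simp add: solves_ivp_def)
  then have "((\<lambda>t. y t $ i) has_real_derivative fine_rhs \<alpha> \<beta> \<gamma> \<zeta> \<sigma> \<epsilon> (y t) $ i) (at t within {0..h})" for i
    unfolding has_real_derivative_iff_has_vector_derivative
    by (rule bounded_linear.has_vector_derivative[OF bounded_linear_vec_nth])
  from this[of 1] this[of 2] this[of 3]
  show "((\<lambda>t. y t $ 1) has_real_derivative 2 * \<alpha> * y t $ 1 + 2 * \<beta> * y t $ 2 + \<sigma>\<^sup>2) (at t within {0..h}) \<and>
     ((\<lambda>t. y t $ 2) has_real_derivative \<gamma> / \<epsilon> * y t $ 1 + (\<alpha> + \<zeta> / \<epsilon>) * y t $ 2 + \<beta> * y t $ 3) (at t within {0..h}) \<and>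
     ((\<lambda>t. y t $ 3) has_real_derivative 2 * \<gamma> / \<epsilon> * y t $ 2 + 2 * \<zeta> / \<epsilon> * y t $ 3 + \<sigma>\<^sup>2 / \<epsilon>) (at t within {0..h})"
    by (simp add: fine_rhs_def B_Sigma_def matrix_vector_mult_def sum_3)
qed

text \<open>Autonomy of the equation; it lets the exact trajectory be read as an orbit of the fine
  propagator.\<close>

lemma solves_ivp_shift:
  assumes y: "solves_ivp f y0 T y" and t: "0 \<le> t" "t + h \<le> T"
  shows "solves_ivp f (y t) h (\<lambda>r. y (t + r))"
  unfolding solves_ivp_def
proof (intro conjI ballI)
  fix r assume r: "r \<in> {0..h}"
  have "(y has_vector_derivative f (y (t + r))) (at (t + r) within {0..T})"
    using y r t by (simp add: solves_ivp_def)
  then have "(y has_vector_derivative f (y (t + r))) (at (t + r) within (+) t ` {0..h})"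
    by (rule has_vector_derivative_within_subset) (use t in auto)
  moreover have "((+) t has_vector_derivative 1) (at r within {0..h})"
    by (auto intro!: derivative_eq_intros)
  ultimately show "((\<lambda>r. y (t + r)) has_vector_derivative f (y (t + r))) (at r within {0..h})"
    using vector_diff_chain_within[of "(+) t" 1 r "{0..h}" y "f (y (t + r))"] by (simp add: o_def)
qed simp

text \<open>The source cancels in the difference of two solutions, so the integral term of
  \<open>linear_ode_bound\<close> is zero and the estimate becomes an equality.\<close>

lemma coarse_map_diff:
  assumes G: "is_solution_map (coarse_rhs \<alpha> \<beta> \<gamma> \<zeta> \<sigma>) h G"
    and \<kappa>: "lambda_Sigma \<alpha> \<beta> \<gamma> \<zeta> \<noteq> 0" and h: "0 \<le> h"
  shows "G a - G b = exp (lambda_Sigma \<alpha> \<beta> \<gamma> \<zeta> * h) * (a - b)"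
proof -
  define \<kappa> where "\<kappa> = lambda_Sigma \<alpha> \<beta> \<gamma> \<zeta>"
  obtain x y where x: "solves_ivp (coarse_rhs \<alpha> \<beta> \<gamma> \<zeta> \<sigma>) a h x" "G a = x h"
    and y: "solves_ivp (coarse_rhs \<alpha> \<beta> \<gamma> \<zeta> \<sigma>) b h y" "G b = y h"
    using G unfolding is_solution_map_def by meson
  have d: "((\<lambda>r. x r - y r) has_real_derivative \<kappa> * (x r - y r) + 0) (at r within {0..h})"
    if "r \<in> {0..h}" for r
  proof -
    have "(x has_real_derivative coarse_rhs \<alpha> \<beta> \<gamma> \<zeta> \<sigma> (x r)) (at r within {0..h})"
      "(y has_real_derivative coarse_rhs \<alpha> \<beta> \<gamma> \<zeta> \<sigma> (y r)) (at r within {0..h})"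
      using x y that by (auto simp: solves_ivp_def has_real_derivative_iff_has_vector_derivative)
    from DERIV_diff[OF this] show ?thesis
      by (simp add: coarse_rhs_def \<kappa>_def algebra_simps)
  qed
  have "\<bar>(x h - y h) - exp (\<kappa> * h) * (x 0 - y 0)\<bar> \<le> 0 * ((exp (\<kappa> * h) - 1) / \<kappa>)"
    by (rule linear_ode_bound[OF _ _ d]) (use \<kappa> h in \<open>auto simp: \<kappa>_def\<close>)
  then show ?thesis using x y by (simp add: solves_ivp_def \<kappa>_def)
qed

lemma macro_iter_eq: "macro_iter G F S0 k n = micro_iter G F S0 k n $ 1"
  by (cases n; cases k) (auto simp: lift_op_def match_op_def)

section \<open>Error propagation in the micro-macro iteration\<close>

theorem lemma8:
  fixes \<alpha> \<beta> \<gamma> \<zeta> T :: real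
  assumes "T > 0"
    and "lambda_Sigma \<alpha> \<beta> \<gamma> \<zeta> \<noteq> 0"
    and "\<forall>\<epsilon>\<in>{0<..<1}. lambda_Sigma_eps \<alpha> \<beta> \<gamma> \<zeta> \<epsilon> \<noteq> 0"
  shows "\<exists>\<epsilon>0\<in>{0<..<1::real}. \<forall>\<mu>>0.
    (\<forall>\<epsilon>\<in>{0<..<1}. \<forall>z. complex_eigenvalue (A_Sigma \<alpha> \<beta> \<gamma> \<zeta> \<epsilon>) z \<longrightarrow> \<mu> \<le> Re z) \<longrightarrow>
    (\<forall>(\<sigma>::real) (\<Sigma>0::real^3) (k::nat) (\<Delta>t::real) (N::nat).
      \<Delta>t > 0 \<and> real N * \<Delta>t = T \<longrightarrow>
      (\<exists>C::real. \<forall>\<epsilon>\<in>{0<..<\<epsilon>0}. \<Delta>t > t_BL \<mu> \<epsilon> \<longrightarrow>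
        (\<forall>\<Sigma> F G.
          solves_ivp (fine_rhs \<alpha> \<beta> \<gamma> \<zeta> \<sigma> \<epsilon>) \<Sigma>0 T \<Sigma> \<and>
          is_solution_map (fine_rhs \<alpha> \<beta> \<gamma> \<zeta> \<sigma> \<epsilon>) \<Delta>t F \<and>
          is_solution_map (coarse_rhs \<alpha> \<beta> \<gamma> \<zeta> \<sigma>) \<Delta>t G \<longrightarrow>
          (SUP n\<in>{0..N}. \<bar>micro_iter G F \<Sigma>0 k n $ 1 - \<Sigma> (real n * \<Delta>t) $ 1\<bar>)
            \<le> C * \<epsilon> ^ nat \<lceil>(real k + 1) / 2\<rceil> \<and>
          (SUP n\<in>{0..N}. norm (micro_iter G F \<Sigma>0 k n - \<Sigma> (real n * \<Delta>t)))
            \<le> C * \<epsilon> ^ nat \<lfloor>(real k + 1) / 2\<rfloor>)))"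
\<comment> \<open>The split comes before \<mu> is fixed because the threshold must precede \<mu>.
  For \<open>\<zeta> \<ge> 0\<close> no positive \<mu> meets the eigenvalue condition, and any
  threshold will do.\<close>
proof (cases "\<zeta> < 0")
  case False
  then show ?thesis
    by (intro bexI[of _ "1/2"] allI impI) (use zeta_negative in \<open>blast, simp\<close>)
next
  case \<zeta>: True
  define \<kappa> where "\<kappa> = lambda_Sigma \<alpha> \<beta> \<gamma> \<zeta>"
  obtain \<epsilon>0 where \<epsilon>0: "0 < \<epsilon>0" "\<epsilon>0 < 1"
    and fb: "\<And>h. 0 < h \<Longrightarrow> h \<le> T \<Longrightarrow> \<exists>K\<ge>0. \<forall>\<epsilon> s x u v. 0 < \<epsilon> \<longrightarrow> \<epsilon> < \<epsilon>0 \<longrightarrow>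
      covariance_flow \<alpha> \<beta> \<gamma> \<zeta> \<epsilon> s h x u v \<longrightarrow>
      (\<forall>t\<in>{0..h}. \<bar>x t\<bar> + (\<bar>u t\<bar> + \<bar>v t\<bar>) \<le> K * (\<bar>x 0\<bar> + (\<bar>u 0\<bar> + \<bar>v 0\<bar>) + \<bar>s\<bar>)) \<and>
      \<bar>u h\<bar> + \<bar>v h\<bar> \<le> K * (\<bar>x 0\<bar> + \<bar>s\<bar>) + K * \<epsilon> * (\<bar>x 0\<bar> + (\<bar>u 0\<bar> + \<bar>v 0\<bar>) + \<bar>s\<bar>) \<and>
      (\<forall>X. X 0 = x 0 \<and> (\<forall>t\<in>{0..h}. (X has_real_derivative lambda_Sigma \<alpha> \<beta> \<gamma> \<zeta> * X t + s)
            (at t within {0..h})) \<longrightarrow>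
        \<bar>x h - X h\<bar> \<le> K * \<epsilon> * (\<bar>x 0\<bar> + (\<bar>u 0\<bar> + \<bar>v 0\<bar>) + \<bar>s\<bar>))"
    by (rule flow_bounds[OF \<zeta> assms(2), of T]) blast
  have main: "\<exists>C\<ge>0. \<forall>\<epsilon> \<Sigma> F G. 0 < \<epsilon> \<longrightarrow> \<epsilon> < \<epsilon>0 \<longrightarrow>
      solves_ivp (fine_rhs \<alpha> \<beta> \<gamma> \<zeta> \<sigma> \<epsilon>) S0 T \<Sigma> \<longrightarrow>
      is_solution_map (fine_rhs \<alpha> \<beta> \<gamma> \<zeta> \<sigma> \<epsilon>) h F \<longrightarrow>
      is_solution_map (coarse_rhs \<alpha> \<beta> \<gamma> \<zeta> \<sigma>) h G \<longrightarrow>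
      (\<forall>n\<le>N. \<bar>micro_iter G F S0 k n $ 1 - \<Sigma> (real n * h) $ 1\<bar> \<le> C * \<epsilon> ^ ((k + 2) div 2) \<and>
        norm (micro_iter G F S0 k n - \<Sigma> (real n * h)) \<le> C * \<epsilon> ^ ((k + 1) div 2))"
    if h: "h > 0" and N: "real N * h = T" for \<sigma> :: real and S0 :: "real^3" and k h N
  proof -
    \<comment> \<open>\<open>T > 0\<close> forces at least one step, so \<open>h \<le> T\<close>,
      and the same threshold covers the single step (\<open>K\<close>) and the whole interval
      (\<open>KT\<close>).\<close>
    have "N \<noteq> 0" using N \<open>T > 0\<close> by (intro notI) simp
    then have "1 * h \<le> real N * h" using h by (intro mult_right_mono) auto
    then have hT: "h \<le> T" using N by simp
    obtain K where K0: "0 \<le> K" and K: "\<And>\<epsilon> s x u v. \<lbrakk>0 < \<epsilon>; \<epsilon> < \<epsilon>0; covariance_flow \<alpha> \<beta> \<gamma> \<zeta> \<epsilon> s h x u v\<rbrakk> \<Longrightarrow>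
      \<bar>u h\<bar> + \<bar>v h\<bar> \<le> K * (\<bar>x 0\<bar> + \<bar>s\<bar>) + K * \<epsilon> * (\<bar>x 0\<bar> + (\<bar>u 0\<bar> + \<bar>v 0\<bar>) + \<bar>s\<bar>) \<and>
      (\<forall>X. X 0 = x 0 \<and> (\<forall>t\<in>{0..h}. (X has_real_derivative \<kappa> * X t + s) (at t within {0..h})) \<longrightarrow>
        \<bar>x h - X h\<bar> \<le> K * \<epsilon> * (\<bar>x 0\<bar> + (\<bar>u 0\<bar> + \<bar>v 0\<bar>) + \<bar>s\<bar>))"
      using fb[OF h hT] unfolding \<kappa>_def by blast
    obtain KT where KT0: "0 \<le> KT" and KT: "\<And>\<epsilon> s x u v t. \<lbrakk>0 < \<epsilon>; \<epsilon> < \<epsilon>0;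
        covariance_flow \<alpha> \<beta> \<gamma> \<zeta> \<epsilon> s T x u v; t \<in> {0..T}\<rbrakk> \<Longrightarrow>
        \<bar>x t\<bar> + (\<bar>u t\<bar> + \<bar>v t\<bar>) \<le> KT * (\<bar>x 0\<bar> + (\<bar>u 0\<bar> + \<bar>v 0\<bar>) + \<bar>s\<bar>)"
      using fb[OF \<open>T > 0\<close> order.refl] by blast
    \<comment> \<open>\<open>m\<close> is the l1 norm; \<open>c\<close> is the coarse slope raised
      to at least 1 for the Gronwall argument; \<open>M\<close> bounds the exact solution on
      \<open>{0..T}\<close> uniformly in \<epsilon>; the summands of \<open>D\<close> come from the
      macro and the micro error at iteration 0.\<close>
    define m where "m = (\<lambda>S::real^3. \<bar>S $ 1\<bar> + (\<bar>S $ 2\<bar> + \<bar>S $ 3\<bar>))"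
    define c where "c = max 1 (exp (\<kappa> * h))"
    define M where "M = KT * (m S0 + \<sigma>\<^sup>2)"
    define D where "D = real N * c ^ N * (K * (M + \<sigma>\<^sup>2)) + (m S0 + M)"
    have c1: "c \<ge> 1" by (simp add: c_def)
    have m0: "0 \<le> m S" for S by (simp add: m_def)
    have M0: "0 \<le> M" using KT0 m0[of S0] by (simp add: M_def)
    have D1: "0 \<le> real N * c ^ N * (K * (M + \<sigma>\<^sup>2))" using c1 K0 M0 by simp
    have D0: "0 \<le> D" using D1 M0 m0[of S0] by (simp add: D_def)
    obtain C where C0: "C \<ge> 0" and C: "\<And>\<epsilon> E f n. \<lbrakk>0 < \<epsilon>; \<epsilon> < 1; \<forall>k. E k 0 = (0::real) \<and> f k 0 = (0::real);
       \<forall>n\<le>N. \<bar>E 0 n\<bar> \<le> D * \<epsilon> \<and> f 0 n \<le> D;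
       \<forall>k n. n < N \<longrightarrow> \<bar>E (Suc k) (Suc n)\<bar> \<le> c * \<bar>E (Suc k) n\<bar> + K * \<epsilon> * (\<bar>E k n\<bar> + f k n) \<and>
         f (Suc k) (Suc n) \<le> K * \<bar>E k n\<bar> + K * \<epsilon> * (\<bar>E k n\<bar> + f k n); n \<le> N\<rbrakk> \<Longrightarrow>
       \<bar>E k n\<bar> \<le> C * \<epsilon> ^ ((k + 2) div 2) \<and> f k n \<le> C * \<epsilon> ^ ((k + 1) div 2)"
      using parareal_error_recursion[OF c1 K0 D0, of N k] by metis
    show ?thesis
    proof (intro exI[of _ "2 * C"] allI impI conjI[of "0 \<le> _"])
      show "0 \<le> 2 * C" using C0 by simp
      fix \<epsilon> \<Sigma> F G n
      assume \<epsilon>: "0 < \<epsilon>" "\<epsilon> < \<epsilon>0" and \<Sigma>: "solves_ivp (fine_rhs \<alpha> \<beta> \<gamma> \<zeta> \<sigma> \<epsilon>) S0 T \<Sigma>"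
        and F: "is_solution_map (fine_rhs \<alpha> \<beta> \<gamma> \<zeta> \<sigma> \<epsilon>) h F"
        and G: "is_solution_map (coarse_rhs \<alpha> \<beta> \<gamma> \<zeta> \<sigma>) h G"
        and n: "n \<le> N"
      have \<epsilon>1: "\<epsilon> < 1" using \<epsilon> \<epsilon>0 by simp
      note Gd = coarse_map_diff[OF G assms(2) less_imp_le[OF h], folded \<kappa>_def]
      \<comment> \<open>The sources cancel in the difference, and the reduced solution to compare
        with is \<open>exp (\<kappa> * t)\<close> times the initial difference.\<close>
      have diff: "\<bar>(y h - y' h) $ 1 - exp (\<kappa> * h) * (S - S') $ 1\<bar> \<le> K * \<epsilon> * m (S - S')"
        "\<bar>(y h - y' h) $ 2\<bar> + \<bar>(y h - y' h) $ 3\<bar> \<le> K * \<bar>(S - S') $ 1\<bar> + K * \<epsilon> * m (S - S')"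
        if y: "solves_ivp (fine_rhs \<alpha> \<beta> \<gamma> \<zeta> \<sigma> \<epsilon>) S h y"
          and y': "solves_ivp (fine_rhs \<alpha> \<beta> \<gamma> \<zeta> \<sigma> \<epsilon>) S' h y'" for S S' y y'
      proof -
        note fl = covariance_flow_diff[OF solves_fine_imp_covariance_flow[OF y] solves_fine_imp_covariance_flow[OF y']]
        note k = K[OF \<epsilon> fl]
        have i: "y 0 = S" "y' 0 = S'" using y y' by (auto simp: solves_ivp_def)
        show "\<bar>(y h - y' h) $ 2\<bar> + \<bar>(y h - y' h) $ 3\<bar> \<le> K * \<bar>(S - S') $ 1\<bar> + K * \<epsilon> * m (S - S')"
          using k[THEN conjunct1] by (simp add: i m_def)
        have "((\<lambda>t. exp (\<kappa> * t) * (S - S') $ 1) has_real_derivative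
           \<kappa> * (exp (\<kappa> * t) * (S - S') $ 1) + (\<sigma>\<^sup>2 - \<sigma>\<^sup>2)) (at t within {0..h})" for t
          by (auto intro!: derivative_eq_intros)
        then show "\<bar>(y h - y' h) $ 1 - exp (\<kappa> * h) * (S - S') $ 1\<bar> \<le> K * \<epsilon> * m (S - S')"
          using k[THEN conjunct2, rule_format, of "\<lambda>t. exp (\<kappa> * t) * (S - S') $ 1"]
          by (simp add: i m_def)
      qed
      have Fd: "\<bar>(F S - F S') $ 1 - exp (\<kappa> * h) * (S - S') $ 1\<bar> \<le> K * \<epsilon> * m (S - S')"
        "\<bar>(F S - F S') $ 2\<bar> + \<bar>(F S - F S') $ 3\<bar> \<le> K * \<bar>(S - S') $ 1\<bar> + K * \<epsilon> * m (S - S')" for S S'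
        using F diff unfolding is_solution_map_def by metis+
      \<comment> \<open>One-step consistency error of the coarse propagator. The flow is
        inhomogeneous here, so \<open>\<sigma>\<^sup>2\<close> enters the bound.\<close>
      have FG: "\<bar>F S $ 1 - G (S $ 1)\<bar> \<le> K * \<epsilon> * (m S + \<sigma>\<^sup>2)" for S
      proof -
        obtain y where y: "solves_ivp (fine_rhs \<alpha> \<beta> \<gamma> \<zeta> \<sigma> \<epsilon>) S h y" "F S = y h"
          using F unfolding is_solution_map_def by meson
        obtain X where X: "solves_ivp (coarse_rhs \<alpha> \<beta> \<gamma> \<zeta> \<sigma>) (S $ 1) h X" "G (S $ 1) = X h"
          using G unfolding is_solution_map_def by meson
        have i: "y 0 = S" "X 0 = S $ 1" using y X by (auto simp: solves_ivp_def)
        have "(X has_real_derivative \<kappa> * X t + \<sigma>\<^sup>2) (at t within {0..h})" if "t \<in> {0..h}" for t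
          using X that unfolding solves_ivp_def coarse_rhs_def \<kappa>_def
          by (auto simp: has_real_derivative_iff_has_vector_derivative)
        then show ?thesis
          using K[OF \<epsilon> solves_fine_imp_covariance_flow[OF y(1)], THEN conjunct2, rule_format, of X]
          by (simp add: i y X m_def)
      qed
      have t: "0 \<le> real j * h" "real j * h \<le> T" if "j \<le> N" for j
        using that h mult_right_mono[of "real j" "real N" h] N by auto
      have F\<Sigma>: "F (\<Sigma> (real j * h)) = \<Sigma> (real (Suc j) * h)" if j: "j < N" for j
      proof -
        obtain y where y: "solves_ivp (fine_rhs \<alpha> \<beta> \<gamma> \<zeta> \<sigma> \<epsilon>) (\<Sigma> (real j * h)) h y"
          "F (\<Sigma> (real j * h)) = y h"
          using F unfolding is_solution_map_def by meson
        have "solves_ivp (fine_rhs \<alpha> \<beta> \<gamma> \<zeta> \<sigma> \<epsilon>) (\<Sigma> (real j * h)) h (\<lambda>r. \<Sigma> (real j * h + r))"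
          by (rule solves_ivp_shift[OF \<Sigma>]) (use t[of j] t[of "Suc j"] j in \<open>auto simp: algebra_simps\<close>)
        \<comment> \<open>With equal initial values both bounds vanish, which is uniqueness of the
          fine solution.\<close>
        from diff[OF y(1) this] have "y h = \<Sigma> (real j * h + h)"
          by (auto simp: m_def vec_eq_iff forall_3)
        then show ?thesis unfolding y(2) by (simp add: algebra_simps)
      qed
      have \<Sigma>0: "\<Sigma> 0 = S0" using \<Sigma> by (simp add: solves_ivp_def)
      have M: "m (\<Sigma> (real j * h)) \<le> M" if "j \<le> N" for j
        using KT[OF \<epsilon> solves_fine_imp_covariance_flow[OF \<Sigma>], of "real j * h"] t[OF that]
        by (simp add: \<Sigma>0 m_def M_def)
      define e where "e = (\<lambda>k n. micro_iter G F S0 k n - \<Sigma> (real n * h))"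
      define E where "E = (\<lambda>k n. e k n $ 1)"
      define f where "f = (\<lambda>k n. \<bar>e k n $ 2\<bar> + \<bar>e k n $ 3\<bar>)"
      have me: "m (e k n) = \<bar>E k n\<bar> + f k n" for k n by (simp add: m_def E_def f_def)
      have e0: "e k 0 = 0" for k by (simp add: e_def \<Sigma>0)
      have cE: "exp (\<kappa> * h) * \<bar>E k j\<bar> \<le> c * \<bar>E k j\<bar>" for k j
        by (intro mult_right_mono) (auto simp: c_def)
      \<comment> \<open>Iteration 0 runs the coarse propagator alone, so consistency errors of order
        \<epsilon> accumulate. The lifted fast components stay at their initial values, hence their
        error is only O(1).\<close>
      have E0: "\<bar>E 0 j\<bar> \<le> D * \<epsilon> \<and> f 0 j \<le> D" if j: "j \<le> N" for j
      proof
        have "\<bar>E 0 j\<bar> \<le> real N * c ^ N * (K * \<epsilon> * (M + \<sigma>\<^sup>2))"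
        proof (rule discrete_gronwall[OF _ _ c1 _ j])
          fix i assume i: "i < N"
          let ?S = "\<Sigma> (real i * h)"
          have "E 0 (Suc i) = (G (micro_iter G F S0 0 i $ 1) - G (?S $ 1)) - (F ?S $ 1 - G (?S $ 1))"
            by (simp add: E_def e_def F\<Sigma>[OF i] lift_op_def macro_iter_eq[of _ _ _ 0 i] del: of_nat_Suc)
          also have "\<dots> = exp (\<kappa> * h) * E 0 i - (F ?S $ 1 - G (?S $ 1))"
            by (simp add: Gd E_def e_def)
          finally have "\<bar>E 0 (Suc i)\<bar> \<le> exp (\<kappa> * h) * \<bar>E 0 i\<bar> + \<bar>F ?S $ 1 - G (?S $ 1)\<bar>"
            using abs_triangle_ineq4[of "exp (\<kappa> * h) * E 0 i" "F ?S $ 1 - G (?S $ 1)"]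
            by (simp add: abs_mult)
          moreover have "K * \<epsilon> * (m ?S + \<sigma>\<^sup>2) \<le> K * \<epsilon> * (M + \<sigma>\<^sup>2)"
            using M[of i] i K0 \<epsilon> by (intro mult_left_mono) auto
          ultimately show "\<bar>E 0 (Suc i)\<bar> \<le> c * \<bar>E 0 i\<bar> + K * \<epsilon> * (M + \<sigma>\<^sup>2)"
            using FG[of ?S] cE[of 0 i] by linarith
        qed (use K0 \<epsilon> M0 in \<open>auto simp: E_def e0\<close>)
        also have "\<dots> = (real N * c ^ N * (K * (M + \<sigma>\<^sup>2))) * \<epsilon>" by simp
        also have "\<dots> \<le> D * \<epsilon>" using \<epsilon> M0 m0[of S0] by (intro mult_right_mono) (auto simp: D_def)
        finally show "\<bar>E 0 j\<bar> \<le> D * \<epsilon>" .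
        have "micro_iter G F S0 0 j $ 2 = S0 $ 2" "micro_iter G F S0 0 j $ 3 = S0 $ 3"
          by (cases j; simp add: lift_op_def)+
        then have "f 0 j \<le> m S0 + m (\<Sigma> (real j * h))"
          unfolding f_def e_def m_def by simp
        then show "f 0 j \<le> D" using M[OF j] D1 by (simp add: D_def)
      qed
      have step: "\<bar>E (Suc k) (Suc j)\<bar> \<le> c * \<bar>E (Suc k) j\<bar> + K * \<epsilon> * (\<bar>E k j\<bar> + f k j) \<and>
         f (Suc k) (Suc j) \<le> K * \<bar>E k j\<bar> + K * \<epsilon> * (\<bar>E k j\<bar> + f k j)" if j: "j < N" for k j
      proof -
        let ?S = "\<Sigma> (real j * h)" and ?y = "micro_iter G F S0 k j"
        note d = Fd[of ?y ?S]
        have y: "?y - ?S = e k j" by (simp add: e_def)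
        \<comment> \<open>The coarse correction contributes
          \<open>exp (\<kappa> * h) * (E (Suc k) j - E k j)\<close>. Its part in
          \<open>E k j\<close> is exactly the coarse prediction of the fine difference, so of the
          latter only an O(\<epsilon>) defect is left.\<close>
        have "E (Suc k) (Suc j) = (G (micro_iter G F S0 (Suc k) j $ 1) - G (?y $ 1)) + (F ?y - F ?S) $ 1"
          by (simp add: E_def e_def F\<Sigma>[OF j] match_op_def macro_iter_eq[of _ _ _ _ j]
              restrict_op_def del: of_nat_Suc)
        also have "\<dots> = exp (\<kappa> * h) * E (Suc k) j + ((F ?y - F ?S) $ 1 - exp (\<kappa> * h) * (?y - ?S) $ 1)"
          by (simp add: Gd E_def e_def algebra_simps)
        finally have "\<bar>E (Suc k) (Suc j)\<bar> \<le> exp (\<kappa> * h) * \<bar>E (Suc k) j\<bar>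
            + \<bar>(F ?y - F ?S) $ 1 - exp (\<kappa> * h) * (?y - ?S) $ 1\<bar>"
          using abs_triangle_ineq[of "exp (\<kappa> * h) * E (Suc k) j"
              "(F ?y - F ?S) $ 1 - exp (\<kappa> * h) * (?y - ?S) $ 1"] by (simp add: abs_mult)
        then have "\<bar>E (Suc k) (Suc j)\<bar> \<le> c * \<bar>E (Suc k) j\<bar> + K * \<epsilon> * (\<bar>E k j\<bar> + f k j)"
          using d(1) cE[of "Suc k" j] unfolding y me by linarith
        moreover have "f (Suc k) (Suc j) = \<bar>(F ?y - F ?S) $ 2\<bar> + \<bar>(F ?y - F ?S) $ 3\<bar>"
          by (simp add: f_def e_def F\<Sigma>[OF j] match_op_def del: of_nat_Suc)
        ultimately show ?thesis using d(2) unfolding y me by (simp add: E_def)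
      qed
      have b: "\<bar>E k n\<bar> \<le> C * \<epsilon> ^ ((k + 2) div 2) \<and> f k n \<le> C * \<epsilon> ^ ((k + 1) div 2)"
        by (rule C[OF \<epsilon>(1) \<epsilon>1 _ _ _ n]) (use E0 step in \<open>auto simp: E_def f_def e0\<close>)
      have p: "0 \<le> C * \<epsilon> ^ ((k + 2) div 2)" using C0 \<epsilon> by simp
      \<comment> \<open>In the full norm the macro part is of no lower order than the fast part;
        adding the two gives the factor 2.\<close>
      have "C * \<epsilon> ^ ((k + 2) div 2) \<le> C * \<epsilon> ^ ((k + 1) div 2)"
        using C0 \<epsilon> \<epsilon>1 by (intro mult_left_mono power_decreasing) (auto simp: div_le_mono)
      moreover have "norm (e k n) \<le> \<bar>E k n\<bar> + f k n"
        using norm_le_l1_cart[of "e k n"] by (simp add: sum_3 E_def f_def)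
      ultimately have "\<bar>E k n\<bar> \<le> 2 * C * \<epsilon> ^ ((k + 2) div 2)" "norm (e k n) \<le> 2 * C * \<epsilon> ^ ((k + 1) div 2)"
        using b p by linarith+
      then show "\<bar>micro_iter G F S0 k n $ 1 - \<Sigma> (real n * h) $ 1\<bar> \<le> 2 * C * \<epsilon> ^ ((k + 2) div 2) \<and>
        norm (micro_iter G F S0 k n - \<Sigma> (real n * h)) \<le> 2 * C * \<epsilon> ^ ((k + 1) div 2)"
        by (simp add: E_def e_def)
    qed
  qed
  \<comment> \<open>The ceiling of half of \<open>k + 1\<close> is the floor of half of
    \<open>k + 2\<close>, whence the shift by 2.\<close>
  have exps: "nat \<lceil>(real k + 1) / 2\<rceil> = (k + 2) div 2" "nat \<lfloor>(real k + 1) / 2\<rfloor> = (k + 1) div 2" for k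
  proof -
    show "nat \<lceil>(real k + 1) / 2\<rceil> = (k + 2) div 2"
    proof (cases "even k")
      case True
      then obtain i where "k = 2 * i" by blast
      moreover have "\<lceil>(real (2 * i) + 1) / 2\<rceil> = int i + 1" by (rule ceiling_unique) auto
      ultimately show ?thesis by (simp del: of_nat_mult)
    next
      case False
      then obtain i where "k = 2 * i + 1" using oddE by blast
      moreover have "\<lceil>(real (2 * i + 1) + 1) / 2\<rceil> = int i + 1" by (rule ceiling_unique) auto
      ultimately show ?thesis by (simp del: of_nat_mult of_nat_add)
    qed
    have "\<lfloor>(real k + 1) / 2\<rfloor> = int ((k + 1) div 2)"
      using floor_divide_of_nat_eq[of "k + 1" 2, where ?'a = real] by (simp add: add.commute)
    then show "nat \<lfloor>(real k + 1) / 2\<rfloor> = (k + 1) div 2" by simp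
  qed
  show ?thesis
  proof (intro bexI[of _ \<epsilon>0] allI impI)
    fix \<sigma> :: real and \<Sigma>0 :: "real^3" and k :: nat and \<Delta>t :: real and N :: nat
    assume "\<Delta>t > 0 \<and> real N * \<Delta>t = T"
    then obtain C where C: "\<And>\<epsilon> \<Sigma> F G n. \<lbrakk>0 < \<epsilon>; \<epsilon> < \<epsilon>0; solves_ivp (fine_rhs \<alpha> \<beta> \<gamma> \<zeta> \<sigma> \<epsilon>) \<Sigma>0 T \<Sigma>;
      is_solution_map (fine_rhs \<alpha> \<beta> \<gamma> \<zeta> \<sigma> \<epsilon>) \<Delta>t F;
      is_solution_map (coarse_rhs \<alpha> \<beta> \<gamma> \<zeta> \<sigma>) \<Delta>t G; n \<le> N\<rbrakk> \<Longrightarrow>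
      \<bar>micro_iter G F \<Sigma>0 k n $ 1 - \<Sigma> (real n * \<Delta>t) $ 1\<bar> \<le> C * \<epsilon> ^ ((k + 2) div 2) \<and>
        norm (micro_iter G F \<Sigma>0 k n - \<Sigma> (real n * \<Delta>t)) \<le> C * \<epsilon> ^ ((k + 1) div 2)"
      using main[of \<Delta>t N \<sigma> \<Sigma>0 k] by blast
    show "\<exists>C. \<forall>\<epsilon>\<in>{0<..<\<epsilon>0}. \<Delta>t > t_BL \<mu> \<epsilon> \<longrightarrow>
        (\<forall>\<Sigma> F G.
          solves_ivp (fine_rhs \<alpha> \<beta> \<gamma> \<zeta> \<sigma> \<epsilon>) \<Sigma>0 T \<Sigma> \<and>
          is_solution_map (fine_rhs \<alpha> \<beta> \<gamma> \<zeta> \<sigma> \<epsilon>) \<Delta>t F \<and>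
          is_solution_map (coarse_rhs \<alpha> \<beta> \<gamma> \<zeta> \<sigma>) \<Delta>t G \<longrightarrow>
          (SUP n\<in>{0..N}. \<bar>micro_iter G F \<Sigma>0 k n $ 1 - \<Sigma> (real n * \<Delta>t) $ 1\<bar>)
            \<le> C * \<epsilon> ^ nat \<lceil>(real k + 1) / 2\<rceil> \<and>
          (SUP n\<in>{0..N}. norm (micro_iter G F \<Sigma>0 k n - \<Sigma> (real n * \<Delta>t)))
            \<le> C * \<epsilon> ^ nat \<lfloor>(real k + 1) / 2\<rfloor>)" for \<mu>
      unfolding exps
      \<comment> \<open>The index 0 makes \<open>{0..N}\<close> nonempty, so the real suprema
        inherit the termwise bounds.\<close>
      by (intro exI[of _ C] ballI allI impI conjI; rule cSUP_least) (use C in auto)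
  qed (use \<epsilon>0 in simp)
qed

end
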